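(* Let $\widetilde{\mathrm{PSL}}(2,\mathbb{R})$ be the universal covering group of $\mathrm{SL}(2,\mathbb{R})$ and let $\mathbb{B}_0=(X_1,X_2,X_3)$ be the basis of its Lie algebra $\mathrm{sl}(2,\mathbb{R})$ with $[X_1,X_2]=2X_3$, $[X_3,X_1]=2X_2$, $[X_3,X_2]=2X_1$. Then any Lorentzian left invariant metric on $\widetilde{\mathrm{PSL}}(2,\mathbb{R})$ is isometric, via an automorphism, to a left invariant metric whose matrix in $\mathbb{B}_0$ is of one of the following seven forms (all parameters real): (1) $\begin{pmatrix}-\mu_1&0&0\\0&\mu_2&0\\0&0&\mu_3\end{pmatrix}$ with $\mu_1>0$, $\mu_2\ge\mu_3>0$; (2) $\begin{pmatrix}\mu_1&0&0\\0&-\mu_2&0\\0&0&\mu_3\end{pmatrix}$ with $\mu_1,\mu_2,\mu_3>0$; (3) $\dfrac{4}{a^2\alpha\sqrt{\alpha^2+\beta^2}}\begin{pmatrix}\frac{\beta^2-\alpha^2}{\sqrt{\alpha^2+\beta^2}}&\beta&0\\ \beta&\sqrt{\alpha^2+\beta^2}&0\\0&0&\frac{a^2\alpha}{\sqrt{\alpha^2+\beta^2}}\end{pmatrix}$ with $a\neq0$, $\alpha>0$, $\beta>0$; (4) $\dfrac{4}{a^2\alpha\sqrt{\alpha^2+\beta^2}}\begin{pmatrix}-\sqrt{\alpha^2+\beta^2}&0&\beta\\0&\frac{a^2\alpha}{\sqrt{\alpha^2+\beta^2}}&0\\ \beta&0&\frac{\alpha^2-\beta^2}{\sqrt{\alpha^2+\beta^2}}\end{pmatrix}$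 with $a\neq0$, $\alpha<0$, $\beta>0$; (5) $\dfrac{16}{v^2-u^2}\begin{pmatrix} u & 0 & v \\ 0 & 2(u+v) & 0 \\ v & 0 & u \end{pmatrix}$ with $v>0$, $-v<u<v$; (6) $\dfrac1{2ab}\begin{pmatrix}a-8&-a&0\\-a&a+8&0\\0&0&\frac{8a}{b}\end{pmatrix}$ with $a\ne0$, $b\neq0$; (7) $\dfrac{2}{a^4(1+2a^2)}\begin{pmatrix}1-4a^4&(1+2a^2)^{3/2}&0\\(1+2a^2)^{3/2}&4a^4+6a^2+1&2\sqrt2\,a^3\\0&2\sqrt2\,a^3&4a^4\end{pmatrix}$ with $a\ne0$.
   Context: A Lorentzian left invariant metric $h$ on a three dimensional Lie group $G$ is identified with a nondegenerate symmetric bilinear form of signature $(+,+,-)$ on the Lie algebra $\mathfrak{g}$; its matrix in a basis $\mathbb{B}_0$ is the Gram matrix of this form. Two left invariant metrics $h_1,h_2$ on $G$ are isometric via an automorphism if there is a Lie group automorphism $\phi$ of $G$ with $h_1=\phi^*h_2$; since $G$ is simply connected, this is equivalent to the existence of a Lie algebra automorphism of $\mathfrak{g}$ pulling back one form to the other. Concretely, $X_1=\begin{pmatrix}0&1\\-1&0\end{pmatrix}$, $X_2=\begin{pmatrix}0&1\\1&0\end{pmatrix}$, $X_3=\begin{pmatrix}1&0\\0&-1\end{pmatrix}$. *)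

theory Defs
  imports "HOL-Analysis.Analysis" "HOL-Algebra.Group"
begin

definition SL2 :: "(real^2^2) monoid" where
  "SL2 = \<lparr>carrier = {A. det A = 1}, mult = (**), one = mat 1\<rparr>"

definition sl2 :: "(real^2^2) set" where
  "sl2 = {A. trace A = 0}"

definition lie_bracket :: "real^2^2 \<Rightarrow> real^2^2 \<Rightarrow> real^2^2" where
  "lie_bracket A B = A ** B - B ** A"

definition X1 :: "real^2^2" where
  "X1 = vector [vector [0, 1], vector [-1, 0]]"

definition X2 :: "real^2^2" where
  "X2 = vector [vector [0, 1], vector [1, 0]]"

definition X3 :: "real^2^2" where
  "X3 = vector [vector [1, 0], vector [0, -1]]"

definition B0 :: "real^2^2^3" where
  "B0 = vector [X1, X2, X3]"

lemma lie_bracket_B0: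
  "lie_bracket X1 X2 = 2 *\<^sub>R X3"
  "lie_bracket X3 X1 = 2 *\<^sub>R X2"
  "lie_bracket X3 X2 = 2 *\<^sub>R X1"
  by (simp_all add: lie_bracket_def X1_def X2_def X3_def matrix_matrix_mult_def
      vec_eq_iff sum_2 forall_2)

lemma span_B0: "span {X1, X2, X3} = sl2"
proof
  show "span {X1, X2, X3} \<subseteq> sl2"
    by (rule span_minimal)
      (auto simp: sl2_def X1_def X2_def X3_def trace_def sum_2 subspace_def
        simp flip: distrib_left)
  show "sl2 \<subseteq> span {X1, X2, X3}"
  proof
    fix A :: "real^2^2"
    assume "A \<in> sl2"
    then have "A$2$2 = - A$1$1"
      by (simp add: sl2_def trace_def sum_2)
    then have "A = ((A$1$2 - A$2$1) / 2) *\<^sub>R X1 + ((A$1$2 + A$2$1) / 2) *\<^sub>R X2 + (A$1$1) *\<^sub>R X3"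
      by (simp add: X1_def X2_def X3_def vec_eq_iff forall_2 field_simps)
    then show "A \<in> span {X1, X2, X3}"
      by (metis (no_types, lifting) insert_iff span_add span_base span_scale)
  qed
qed

text \<open>
  The universal covering group of \<open>SL(2,\<real>)\<close>: a simply connected topological group \<open>G\<close> with a
  covering homomorphism \<open>p\<close> onto \<open>SL(2,\<real>)\<close>. It is unique up to isomorphism. Asking its
  carrier to be a subset of a normed space (as the covering theory of the library does) is no
  restriction, since the group is homeomorphic to \<open>\<real>\<^sup>3\<close>. The Lie group structure of \<open>G\<close> is the
  one for which \<open>p\<close> is a local diffeomorphism.
\<close>

definition universal_covering_SL2 ::
    "('g::real_normed_vector) monoid \<Rightarrow> ('g \<Rightarrow> real^2^2) \<Rightarrow> bool" where
  "universal_covering_SL2 G p \<longleftrightarrow>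
     group G \<and>
     continuous_on (carrier G \<times> carrier G) (\<lambda>(x, y). x \<otimes>\<^bsub>G\<^esub> y) \<and>
     continuous_on (carrier G) (\<lambda>x. inv\<^bsub>G\<^esub> x) \<and>
     simply_connected (carrier G) \<and>
     p \<in> hom G SL2 \<and>
     covering_space (carrier G) p (carrier SL2)"

text \<open>
  The tangent space of \<open>G\<close> at \<open>g\<close>, identified by \<open>dp\<close> with the tangent space
  \<open>p(g) sl(2,\<real>)\<close> of \<open>SL(2,\<real>)\<close> at \<open>p(g)\<close>. At the neutral element it is \<open>sl(2,\<real>)\<close>.
\<close>

definition tangent_at :: "('g \<Rightarrow> real^2^2) \<Rightarrow> 'g \<Rightarrow> (real^2^2) set" where
  "tangent_at p g = (\<lambda>A. p g ** A) ` sl2"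

text \<open>
  A symmetric bilinear form on the three-dimensional space \<open>V\<close> that is nondegenerate of
  signature \<open>(+,+,-)\<close>, i.e. has Gram matrix \<open>diag(1,1,-1)\<close> in some basis; its values
  outside \<open>V\<close> are irrelevant.
\<close>

definition lorentzian_form_on ::
    "(real^2^2) set \<Rightarrow> (real^2^2 \<Rightarrow> real^2^2 \<Rightarrow> real) \<Rightarrow> bool" where
  "lorentzian_form_on V b \<longleftrightarrow>
     (\<forall>x\<in>V. \<forall>y\<in>V. b x y = b y x) \<and>
     (\<forall>x\<in>V. \<forall>y\<in>V. \<forall>z\<in>V. b (x + y) z = b x z + b y z) \<and>
     (\<forall>c. \<forall>x\<in>V. \<forall>y\<in>V. b (c *\<^sub>R x) y = c * b x y) \<and>
     (\<exists>e1 e2 e3. span {e1, e2, e3} = V \<and>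
        b e1 e1 = 1 \<and> b e2 e2 = 1 \<and> b e3 e3 = -1 \<and>
        b e1 e2 = 0 \<and> b e1 e3 = 0 \<and> b e2 e3 = 0)"

text \<open>
  As \<open>p\<close> is a homomorphism, the differential of the left translation by \<open>k\<close> acts on the
  tangent spaces above as left multiplication by \<open>p(k)\<close>. A left invariant tensor field is
  automatically smooth.
\<close>

definition lorentzian_left_invariant ::
    "('g, 'm) monoid_scheme \<Rightarrow> ('g \<Rightarrow> real^2^2) \<Rightarrow> ('g \<Rightarrow> real^2^2 \<Rightarrow> real^2^2 \<Rightarrow> real) \<Rightarrow> bool"
  where
  "lorentzian_left_invariant G p h \<longleftrightarrow>
     (\<forall>g\<in>carrier G. lorentzian_form_on (tangent_at p g) (h g)) \<and>
     (\<forall>k\<in>carrier G. \<forall>g\<in>carrier G. \<forall>A\<in>tangent_at p g. \<forall>B\<in>tangent_at p g.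
        h (k \<otimes>\<^bsub>G\<^esub> g) (p k ** A) (p k ** B) = h g A B)"

text \<open>Continuous homomorphisms of Lie groups are smooth.\<close>

definition lie_group_automorphism ::
    "('g::real_normed_vector, 'm) monoid_scheme \<Rightarrow> ('g \<Rightarrow> 'g) \<Rightarrow> bool" where
  "lie_group_automorphism G \<phi> \<longleftrightarrow>
     \<phi> \<in> iso G G \<and>
     continuous_on (carrier G) \<phi> \<and>
     continuous_on (carrier G) (inv_into (carrier G) \<phi>)"

text \<open>
  \<open>L\<close> is the differential of \<open>\<phi>\<close> at \<open>g\<close>: it sends the velocity of a curve through \<open>g\<close> to the
  velocity of the image curve, velocities being read off after projecting by \<open>p\<close>. Only the
  values of \<open>L\<close> on the tangent space at \<open>g\<close> are determined by this.
\<close>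

definition has_differential ::
    "('g::real_normed_vector, 'm) monoid_scheme \<Rightarrow> ('g \<Rightarrow> real^2^2) \<Rightarrow> ('g \<Rightarrow> 'g) \<Rightarrow> 'g \<Rightarrow>
     (real^2^2 \<Rightarrow> real^2^2) \<Rightarrow> bool" where
  "has_differential G p \<phi> g L \<longleftrightarrow>
     linear L \<and>
     (\<forall>c v. continuous_on (UNIV :: real set) c \<and> range c \<subseteq> carrier G \<and> c 0 = g \<and>
        ((\<lambda>t. p (c t)) has_vector_derivative v) (at 0) \<longrightarrow>
        ((\<lambda>t. p (\<phi> (c t))) has_vector_derivative L v) (at 0))"

text \<open>\<open>h1\<close> is the pullback of \<open>h2\<close> by a Lie group automorphism of \<open>G\<close>.\<close>

definition isometric_via_automorphism ::
    "('g::real_normed_vector, 'm) monoid_scheme \<Rightarrow> ('g \<Rightarrow> real^2^2) \<Rightarrow>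
     ('g \<Rightarrow> real^2^2 \<Rightarrow> real^2^2 \<Rightarrow> real) \<Rightarrow> ('g \<Rightarrow> real^2^2 \<Rightarrow> real^2^2 \<Rightarrow> real) \<Rightarrow> bool" where
  "isometric_via_automorphism G p h1 h2 \<longleftrightarrow>
     (\<exists>\<phi> D. lie_group_automorphism G \<phi> \<and>
        (\<forall>g\<in>carrier G. has_differential G p \<phi> g (D g) \<and>
           (\<forall>A\<in>tangent_at p g. \<forall>B\<in>tangent_at p g.
              h1 g A B = h2 (\<phi> g) (D g A) (D g B))))"

definition matrix_in_B0 ::
    "('g, 'm) monoid_scheme \<Rightarrow> ('g \<Rightarrow> real^2^2 \<Rightarrow> real^2^2 \<Rightarrow> real) \<Rightarrow> real^3^3" where
  "matrix_in_B0 G h = (\<chi> i j. h \<one>\<^bsub>G\<^esub> (B0 $ i) (B0 $ j))"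

text \<open>The matrix with the given rows.\<close>

definition mat3 ::
    "real \<Rightarrow> real \<Rightarrow> real \<Rightarrow> real \<Rightarrow> real \<Rightarrow> real \<Rightarrow> real \<Rightarrow> real \<Rightarrow> real \<Rightarrow> real^3^3" where
  "mat3 a b c d e f g h i = vector [vector [a, b, c], vector [d, e, f], vector [g, h, i]]"

end

theory Submission
  imports Defs
begin

text \<open>
  A left invariant metric is a Lorentzian form on \<open>sl2\<close>. Besides it, \<open>sl2\<close> carries the
  \<open>Ad\<close>-invariant Killing form, a multiple of \<open>diag(-1,1,1)\<close> in the basis \<open>B0\<close>, and \<open>SL2\<close> acts
  through \<open>Ad\<close> as the identity component of its orthogonal group. Relative to the Killing form the
  metric is a self-adjoint operator, which has a real eigenvector because the dimension is odd.
  Rotations and boosts move an eigenvector into a coordinate axis or onto a null line. A spacelike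
  eigenvector splits off a Lorentzian plane, on which a boost settles the real diagonalizable, the
  complex and the rank two Jordan case; a timelike one leaves a definite plane, which a rotation
  diagonalizes; a null one leads back to the split case after a shear, unless there is a single
  Jordan block of rank three, which is form (7).

  Inner automorphisms suffice. An outer one could only be needed to reverse the sign of the nilpotent
  part of the rank three Jordan block, and form (7) realizes both signs by \<open>a\<close> and \<open>-a\<close>. So the
  metric is pulled back by conjugation with a preimage in \<open>G\<close> of an element of \<open>SL2\<close>.
\<close>

subsection \<open>The adjoint action on Gram matrices\<close>

text \<open>Conjugation by \<open>P\<close> in coordinates: row \<open>i\<close> holds those of
  \<open>P ** B0$i ** adj2 P\<close> in \<open>B0\<close>.\<close>

definition Ad_mat :: "real^2^2 \<Rightarrow> real^3^3" where
  "Ad_mat P = (let a = P$1$1; b = P$1$2; c = P$2$1; d = P$2$2 in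
     mat3 ((a^2+b^2+c^2+d^2)/2) ((a^2+b^2-c^2-d^2)/2) (- (a*c+b*d))
          ((a^2-b^2+c^2-d^2)/2) ((a^2-b^2-c^2+d^2)/2) (b*d-a*c)
          (- (a*b+c*d)) (c*d-a*b) (a*d+b*c))"

text \<open>The adjugate, a polynomial stand-in for the inverse that agrees with it on
  \<open>SL2\<close>.\<close>

definition adj2 :: "real^2^2 \<Rightarrow> real^2^2" where
  "adj2 P = vector [vector [P$2$2, - P$1$2], vector [- P$2$1, P$1$1]]"

lemma mat3_nth [simp]:
  "mat3 a b c d e f g h i $ 1 $ 1 = a" "mat3 a b c d e f g h i $ 1 $ 2 = b"
  "mat3 a b c d e f g h i $ 1 $ 3 = c" "mat3 a b c d e f g h i $ 2 $ 1 = d"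
  "mat3 a b c d e f g h i $ 2 $ 2 = e" "mat3 a b c d e f g h i $ 2 $ 3 = f"
  "mat3 a b c d e f g h i $ 3 $ 1 = g" "mat3 a b c d e f g h i $ 3 $ 2 = h"
  "mat3 a b c d e f g h i $ 3 $ 3 = i"
  by (simp_all add: mat3_def)

lemma mat3_eq_iff: "M = mat3 a b c d e f g h i \<longleftrightarrow>
   M$1$1 = a \<and> M$1$2 = b \<and> M$1$3 = c \<and> M$2$1 = d \<and> M$2$2 = e \<and> M$2$3 = f \<and>
   M$3$1 = g \<and> M$3$2 = h \<and> M$3$3 = i"
  by (auto simp: vec_eq_iff forall_3)

lemma mat3_mult: "mat3 a b c d e f g h i ** mat3 a' b' c' d' e' f' g' h' i' =
  mat3 (a*a'+b*d'+c*g') (a*b'+b*e'+c*h') (a*c'+b*f'+c*i')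
       (d*a'+e*d'+f*g') (d*b'+e*e'+f*h') (d*c'+e*f'+f*i')
       (g*a'+h*d'+i*g') (g*b'+h*e'+i*h') (g*c'+h*f'+i*i')"
  by (simp add: mat3_eq_iff matrix_matrix_mult_def sum_3)

lemma transpose_mat3: "transpose (mat3 a b c d e f g h i) = mat3 a d g b e h c f i"
  by (simp add: mat3_eq_iff transpose_def)

lemma det_mat3: "det (mat3 a b c d e f g h i) =
    a * e * i + b * f * g + c * d * h - a * f * h - b * d * i - c * e * g"
  by (simp add: det_3)

lemma adj2_mult: "adj2 P ** P = mat (det P)" "P ** adj2 P = mat (det P)"
  by (simp_all add: adj2_def matrix_matrix_mult_def vec_eq_iff forall_2 sum_2 det_2 mat_def)

lemma Ad_mat_conj: "P ** B0$i ** adj2 P = (\<Sum>j\<in>UNIV. Ad_mat P $ i $ j *\<^sub>R B0$j)"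
proof -
  have "\<forall>i. P ** B0$i ** adj2 P = (\<Sum>j\<in>UNIV. Ad_mat P $ i $ j *\<^sub>R B0$j)"
    by (simp add: forall_3 forall_2 sum_3 sum_2 B0_def X1_def X2_def X3_def adj2_def
        matrix_matrix_mult_def vec_eq_iff Ad_mat_def Let_def field_simps power2_eq_square)
  then show ?thesis ..
qed

text \<open>The factors swap because coordinates are stored in rows.\<close>

lemma Ad_mat_mult: "Ad_mat (P ** Q) = Ad_mat Q ** Ad_mat P"
  unfolding Ad_mat_def Let_def mat3_mult
  by (simp add: matrix_matrix_mult_def sum_2 mat3_eq_iff) (simp add: field_simps power2_eq_square)

text \<open>Gram matrix of the vectors whose coordinates are the rows of \<open>S\<close>, in a
  basis with Gram matrix \<open>M\<close>.\<close>

definition congr :: "real^3^3 \<Rightarrow> real^3^3 \<Rightarrow> real^3^3" where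
  "congr S M = S ** M ** transpose S"

lemma congr_congr: "congr S (congr T M) = congr (S ** T) M"
  by (simp add: congr_def matrix_transpose_mul matrix_mul_assoc)

lemma det_congr: "det (congr S M) = (det S)^2 * det M"
  by (simp add: congr_def det_mul power2_eq_square)

text \<open>Gram matrix in \<open>B0\<close> of half the trace of a product, one eighth of the
  Killing form.\<close>

abbreviation killing :: "real^3^3" where "killing \<equiv> mat3 (-1) 0 0 0 1 0 0 0 1"

text \<open>Conjugation leaves the trace of a product unchanged.\<close>

lemma congr_Ad_mat_killing:
  assumes "det P = 1"
  shows "congr (Ad_mat P) killing = killing"
proof -
  define a b c d where "a = P$1$1" "b = P$1$2" "c = P$2$1" "d = P$2$2"
  have "a*d-b*c = 1" using assms by (simp add: det_2 a_b_c_d_def)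
  then show ?thesis
    unfolding Ad_mat_def Let_def mat3_mult transpose_mat3 congr_def a_b_c_d_def[symmetric]
    by (simp add: mat3_eq_iff, simp add: field_simps) (intro conjI, algebra+)
qed

definition sym3 :: "real \<Rightarrow> real \<Rightarrow> real \<Rightarrow> real \<Rightarrow> real \<Rightarrow> real \<Rightarrow> real^3^3" where
  "sym3 p q r s t u = mat3 p q r q s t r t u"

text \<open>
  The Gram matrix of the form with values \<open>A = b(n,n)\<close>, \<open>B = b(m,m)\<close>, \<open>C = b(n,m)\<close>,
  \<open>F = b(n,X3)\<close>, \<open>G = b(m,X3)\<close>, \<open>u = b(X3,X3)\<close>, where \<open>n = X1 + X2\<close> and \<open>m = X1 - X2\<close> are null
  for the Killing form.
\<close>

definition nullform :: "real \<Rightarrow> real \<Rightarrow> real \<Rightarrow> real \<Rightarrow> real \<Rightarrow> real \<Rightarrow> real^3^3" where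
  "nullform A B C F G u =
     sym3 ((A+B+2*C)/4) ((A-B)/4) ((F+G)/2) ((A+B-2*C)/4) ((F-G)/2) u"

section \<open>Rotations, boosts and shears\<close>

definition conjugate :: "real^3^3 \<Rightarrow> real^3^3 \<Rightarrow> bool" where
  "conjugate M N \<longleftrightarrow> (\<exists>P. det P = 1 \<and> N = congr (Ad_mat P) M)"

lemma conjugate_trans [trans]: "conjugate L M \<Longrightarrow> conjugate M N \<Longrightarrow> conjugate L N"
  unfolding conjugate_def
  by (metis congr_congr Ad_mat_mult det_mul mult_1)

lemma conjugate_rotate:
  assumes "c^2 + s^2 = 1"
  shows "conjugate M (congr (mat3 1 0 0 0 c (-s) 0 s c) M)"
proof -
  obtain \<theta> where \<theta>: "c = cos \<theta>" "s = sin \<theta>"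
    using assms sincos_total_2pi by metis
  \<comment> \<open>Rotations in \<open>SL2\<close> cover those about \<open>X1\<close> twice, so
    the half angle in \<open>P\<close> acts by \<theta> on \<open>X2\<close> and
    \<open>X3\<close>.\<close>
  define P :: "real^2^2" where
    "P = vector [vector [cos (\<theta>/2), - sin (\<theta>/2)], vector [sin (\<theta>/2), cos (\<theta>/2)]]"
  define x y where "x = sin (\<theta>/2)" "y = cos (\<theta>/2)"
  have *: "y * y = 1 - x * x"
    using sin_cos_squared_add[of "\<theta>/2"] by (simp add: x_y_def power2_eq_square)
  have "c = y^2 - x^2" "s = 2 * x * y"
    using cos_double[of "\<theta>/2"] sin_double[of "\<theta>/2"] by (simp_all add: \<theta> x_y_def)
  then have "Ad_mat P = mat3 1 0 0 0 c (-s) 0 s c"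
    unfolding mat3_eq_iff Ad_mat_def Let_def P_def x_y_def[symmetric]
    by (simp add: power2_eq_square *)
  moreover have "det P = 1" using * by (simp add: P_def det_2 flip: x_y_def)
  ultimately show ?thesis unfolding conjugate_def by metis
qed

lemma conjugate_rotate_sym3:
  assumes "c^2 + s^2 = 1"
  shows "conjugate (sym3 p q r x y z)
    (sym3 p (c*q-s*r) (s*q+c*r) (c^2*x-2*c * s*y+s^2*z) (c * s*(x-z)+(c^2-s^2)*y) (s^2*x+2*c * s*y+c^2*z))"
proof -
  have "congr (mat3 1 0 0 0 c (-s) 0 s c) (sym3 p q r x y z) =
   (sym3 p (c*q-s*r) (s*q+c*r) (c^2*x-2*c * s*y+s^2*z) (c * s*(x-z)+(c^2-s^2)*y) (s^2*x+2*c * s*y+c^2*z))"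
    by (simp add: congr_def sym3_def transpose_mat3 mat3_mult)
       (simp add: mat3_eq_iff algebra_simps power2_eq_square)
  then show ?thesis using conjugate_rotate[OF assms] by metis
qed

text \<open>The diagonal element multiplies \<open>n\<close> by \<open>k\<close> and
  \<open>m\<close> by \<open>1/k\<close>, and fixes \<open>X3\<close>.\<close>

lemma Ad_mat_boost:
  assumes "k > 0"
  shows "det (vector [vector [sqrt k, 0], vector [0, 1 / sqrt k]] :: real^2^2) = 1"
   "Ad_mat (vector [vector [sqrt k, 0], vector [0, 1 / sqrt k]])
     = mat3 ((k+1/k)/2) ((k-1/k)/2) 0 ((k-1/k)/2) ((k+1/k)/2) 0 0 0 1"
  using assms unfolding mat3_eq_iff by (simp_all add: det_2 Ad_mat_def Let_def power_divide)

lemma conjugate_boost_nullform: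
  assumes "k > 0"
  shows "conjugate (nullform A B C F G u) (nullform (k^2*A) (B/k^2) C (k*F) (G/k) u)"
proof -
  have "congr (mat3 ((k+1/k)/2) ((k-1/k)/2) 0 ((k-1/k)/2) ((k+1/k)/2) 0 0 0 1) (nullform A B C F G u)
    = nullform (k^2*A) (B/k^2) C (k*F) (G/k) u"
    using assms by (simp add: congr_def nullform_def sym3_def transpose_mat3 mat3_mult)
       (simp add: mat3_eq_iff field_simps power2_eq_square)
  then show ?thesis using Ad_mat_boost[OF assms] unfolding conjugate_def by metis
qed

text \<open>The unipotent element fixes \<open>n\<close> and sends \<open>X3\<close> to
  \<open>X3 + x n\<close> and \<open>m\<close> to \<open>m + 2x X3 + x^2 n\<close>. The factor
  \<open>2*u+C\<close> is twice the difference of the eigenvalues \<open>u\<close> and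
  \<open>-C/2\<close> relative to \<open>killing\<close>.\<close>

lemma conjugate_shear_nullform:
  "conjugate (nullform 0 B C 0 G u)
     (nullform 0 (B + 4*x*G + 2*x^2*(2*u+C)) C 0 (G + x*(2*u+C)) u)"
proof -
  define P :: "real^2^2" where "P = vector [vector [1, -x], vector [0, 1]]"
  have "congr (Ad_mat P) (nullform 0 B C 0 G u)
    = nullform 0 (B + 4*x*G + 2*x^2*(2*u+C)) C 0 (G + x*(2*u+C)) u"
    by (simp add: congr_def nullform_def sym3_def transpose_mat3 mat3_mult Ad_mat_def P_def Let_def)
       (simp add: mat3_eq_iff field_simps power2_eq_square)
  moreover have "det P = 1" by (simp add: P_def det_2)
  ultimately show ?thesis unfolding conjugate_def by metis
qed


text \<open>
  For symmetric matrices this is signature \<open>(+,+,-)\<close>: a negative determinant leaves only that and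
  the negative definite case.
\<close>

definition lorentz :: "real^3^3 \<Rightarrow> bool" where
  "lorentz M \<longleftrightarrow> det M < 0 \<and> (\<exists>v. v \<bullet> (M *v v) > 0)"

text \<open>The determinant is multiplied by a square, and the inverse of \<open>transpose S\<close>
  carries a positive vector along.\<close>

lemma lorentz_congr:
  assumes "lorentz M" "det S \<noteq> 0"
  shows "lorentz (congr S M)"
proof -
  from assms(1) obtain v where v: "v \<bullet> (M *v v) > 0" and d: "det M < 0"
    by (auto simp: lorentz_def)
  have "invertible (transpose S)" using assms(2) by (simp add: invertible_det_nz)
  then obtain T where T: "transpose S ** T = mat 1" by (auto simp: invertible_def)
  define w where "w = T *v v"
  have w: "transpose S *v w = v" by (simp add: w_def matrix_vector_mul_assoc T)
  have "w \<bullet> (congr S M *v w) = w \<bullet> (S *v (M *v (transpose S *v w)))"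
    by (simp add: congr_def matrix_vector_mul_assoc matrix_mul_assoc del: transpose_matrix_vector)
  also have "\<dots> = (transpose S *v w) \<bullet> (M *v (transpose S *v w))"
    by (metis dot_lmul_matrix matrix_transpose_mul transpose_matrix_vector)
  finally have "w \<bullet> (congr S M *v w) > 0" using v w by simp
  moreover have "det (congr S M) < 0" using d assms(2) by (simp add: det_congr mult_pos_neg)
  ultimately show ?thesis by (auto simp: lorentz_def)
qed

text \<open>\<open>Ad_mat P\<close> is invertible since it preserves the nondegenerate
  \<open>killing\<close>.\<close>

lemma lorentz_conjugate:
  assumes "lorentz M" "conjugate M N"
  shows "lorentz N"
proof -
  obtain P where P: "det P = 1" "N = congr (Ad_mat P) M"
    using assms(2) by (auto simp: conjugate_def)
  have "det (congr (Ad_mat P) killing) \<noteq> 0"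
    by (simp add: congr_Ad_mat_killing[OF P(1)] det_mat3)
  then have "det (Ad_mat P) \<noteq> 0" by (simp add: det_congr)
  then show ?thesis using lorentz_congr assms(1) P by blast
qed

subsection \<open>Reduction of a block\<close>

definition normal_form1 :: "real^3^3 \<Rightarrow> bool" where
  "normal_form1 M \<longleftrightarrow>
     (\<exists>\<mu>1 \<mu>2 \<mu>3. \<mu>1 > 0 \<and> \<mu>2 \<ge> \<mu>3 \<and> \<mu>3 > 0 \<and>
        M =
          mat3 (- \<mu>1) 0 0
               0 \<mu>2 0
               0 0 \<mu>3)"

definition normal_form2 :: "real^3^3 \<Rightarrow> bool" where
  "normal_form2 M \<longleftrightarrow>
     (\<exists>\<mu>1 \<mu>2 \<mu>3. \<mu>1 > 0 \<and> \<mu>2 > 0 \<and> \<mu>3 > 0 \<and>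
        M =
          mat3 \<mu>1 0 0
               0 (- \<mu>2) 0
               0 0 \<mu>3)"

definition normal_form3 :: "real^3^3 \<Rightarrow> bool" where
  "normal_form3 M \<longleftrightarrow>
     (\<exists>a \<alpha> \<beta>. a \<noteq> 0 \<and> \<alpha> > 0 \<and> \<beta> > 0 \<and>
        M = (4 / (a^2 * \<alpha> * sqrt (\<alpha>^2 + \<beta>^2))) *\<^sub>R
          mat3 ((\<beta>^2 - \<alpha>^2) / sqrt (\<alpha>^2 + \<beta>^2)) \<beta> 0
               \<beta> (sqrt (\<alpha>^2 + \<beta>^2)) 0
               0 0 (a^2 * \<alpha> / sqrt (\<alpha>^2 + \<beta>^2)))"

definition normal_form4 :: "real^3^3 \<Rightarrow> bool" where
  "normal_form4 M \<longleftrightarrow>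
     (\<exists>a \<alpha> \<beta>. a \<noteq> 0 \<and> \<alpha> < 0 \<and> \<beta> > 0 \<and>
        M = (4 / (a^2 * \<alpha> * sqrt (\<alpha>^2 + \<beta>^2))) *\<^sub>R
          mat3 (- sqrt (\<alpha>^2 + \<beta>^2)) 0 \<beta>
               0 (a^2 * \<alpha> / sqrt (\<alpha>^2 + \<beta>^2)) 0
               \<beta> 0 ((\<alpha>^2 - \<beta>^2) / sqrt (\<alpha>^2 + \<beta>^2)))"

definition normal_form5 :: "real^3^3 \<Rightarrow> bool" where
  "normal_form5 M \<longleftrightarrow>
     (\<exists>u v. v > 0 \<and> - v < u \<and> u < v \<and>
        M = (16 / (v^2 - u^2)) *\<^sub>R
          mat3 u 0 v
               0 (2 * (u + v)) 0
               v 0 u)"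

definition normal_form6 :: "real^3^3 \<Rightarrow> bool" where
  "normal_form6 M \<longleftrightarrow>
     (\<exists>a b. a \<noteq> 0 \<and> b \<noteq> 0 \<and>
        M = (1 / (2 * a * b)) *\<^sub>R
          mat3 (a - 8) (- a) 0
               (- a) (a + 8) 0
               0 0 (8 * a / b))"

definition normal_form7 :: "real^3^3 \<Rightarrow> bool" where
  "normal_form7 M \<longleftrightarrow>
     (\<exists>a. a \<noteq> 0 \<and>
        M = (2 / (a^4 * (1 + 2 * a^2))) *\<^sub>R
          mat3 (1 - 4 * a^4) ((1 + 2 * a^2) powr (3/2)) 0
               ((1 + 2 * a^2) powr (3/2)) (4 * a^4 + 6 * a^2 + 1) (2 * sqrt 2 * a^3)
               0 (2 * sqrt 2 * a^3) (4 * a^4))"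

definition normal_form :: "real^3^3 \<Rightarrow> bool" where
  "normal_form M \<longleftrightarrow> normal_form1 M \<or> normal_form2 M \<or> normal_form3 M \<or> normal_form4 M \<or>
     normal_form5 M \<or> normal_form6 M \<or> normal_form7 M"

definition reducible :: "real^3^3 \<Rightarrow> bool" where
  "reducible M \<longleftrightarrow> (\<exists>N. conjugate M N \<and> normal_form N)"

lemma reducible_conjugate: "conjugate M N \<Longrightarrow> reducible N \<Longrightarrow> reducible M"
  unfolding reducible_def using conjugate_trans by blast

lemma conjugate_refl: "conjugate M M"
proof -
  have "congr (mat3 1 0 0 0 1 (-0) 0 0 1) M = M"
    by (simp add: congr_def transpose_mat3 matrix_matrix_mult_def vec_eq_iff forall_3 sum_3)
  then show ?thesis using conjugate_rotate[of 1 0 M] by simp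
qed

lemma reducible_normal_form: "normal_form M \<Longrightarrow> reducible M"
  unfolding reducible_def using conjugate_refl by blast

text \<open>Exchanges \<open>X2\<close> and \<open>X3\<close> up to sign, which moves a splitting
  along one to a splitting along the other.\<close>

lemma conjugate_quarter_turn: "conjugate (sym3 p q r x y z) (sym3 p (-r) q z (-y) x)"
  using conjugate_rotate_sym3[of 0 1 p q r x y z] by simp

text \<open>Negating \<open>X2\<close> and \<open>X3\<close> interchanges \<open>n\<close> and
  \<open>m\<close>.\<close>

lemma conjugate_half_turn_nullform:
  "conjugate (nullform A B C F G u) (nullform B A C (-G) (-F) u)"
proof -
  have "conjugate (nullform A B C F G u)
    (sym3 ((A+B+2*C)/4) (-((A-B)/4)) (-((F+G)/2)) ((A+B-2*C)/4) ((F-G)/2) u)"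
    using conjugate_rotate_sym3[of "-1" 0] unfolding nullform_def by simp
  moreover have "(sym3 ((A+B+2*C)/4) (-((A-B)/4)) (-((F+G)/2)) ((A+B-2*C)/4) ((F-G)/2) u)
     = nullform B A C (-G) (-F) u" by (simp add: nullform_def sym3_def mat3_eq_iff field_simps)
  ultimately show ?thesis by simp
qed

lemma sym3_eq_nullform:
  "sym3 p q r s t u = nullform (p+2*q+s) (p-2*q+s) (p-s) (r+t) (r-t) u"
  by (simp add: nullform_def sym3_def mat3_eq_iff field_simps)

lemma sym3_quadratic: "v \<bullet> (sym3 p q r s t u *v v) =
   p*(v$1)^2 + 2*q* v$1* v$2 + 2*r* v$1* v$3 + s*(v$2)^2 + 2*t* v$2* v$3 + u*(v$3)^2"
  by (simp add: sym3_def inner_vec_def matrix_vector_mult_def sum_3 algebra_simps power2_eq_square)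

text \<open>Exactly one entry is negative. On \<open>X1\<close> this is form (1), where a quarter
  turn orders the positive entries; otherwise a quarter turn brings it to \<open>X2\<close> if
  necessary, for form (2).\<close>

lemma reducible_diagonal:
  assumes "lorentz (sym3 p 0 0 q 0 r)"
  shows "reducible (sym3 p 0 0 q 0 r)"
proof -
  have det: "p * q * r < 0" using assms by (simp add: lorentz_def sym3_def det_mat3)
  have pos: "p > 0 \<or> q > 0 \<or> r > 0"
  proof (rule ccontr)
    assume "\<not> ?thesis"
    then have "p * x^2 \<le> 0" "q * x^2 \<le> 0" "r * x^2 \<le> 0" for x
      by (simp_all add: mult_nonpos_nonneg)
    moreover obtain v :: "real^3" where "p*(v$1)^2 + q*(v$2)^2 + r*(v$3)^2 > 0"
      using assms unfolding lorentz_def sym3_quadratic by auto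
    ultimately show False by (smt (verit))
  qed
  have swap: "conjugate (sym3 p 0 0 q 0 r) (sym3 p 0 0 r 0 q)"
    using conjugate_quarter_turn[of p 0 0 q 0 r] by simp
  show ?thesis
  proof (cases "p < 0")
    case True
    then have "q * r > 0" using det by (simp add: mult.assoc mult_less_0_iff)
    then have "q > 0" "r > 0" using pos True by (auto simp: zero_less_mult_iff)
    have *: "normal_form (sym3 p 0 0 b 0 c)" if "b \<ge> c" "c > 0" for b c
      unfolding normal_form_def normal_form1_def sym3_def using that True
      by - (rule disjI1, rule exI[of _ "-p"], rule exI[of _ b], rule exI[of _ c], simp)
    show ?thesis
    proof (cases "q \<ge> r")
      case True
      then show ?thesis using * \<open>r > 0\<close> by (simp add: reducible_normal_form)
    next
      case False
      then show ?thesis using *[of q r] \<open>q > 0\<close> * swap unfolding reducible_def by force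
    qed
  next
    case False
    then have "p > 0" using det by (cases "p = 0") auto
    then have qr: "q * r < 0" using det by (simp add: mult.assoc mult_less_0_iff)
    have *: "normal_form (sym3 p 0 0 b 0 c)" if "b < 0" "c > 0" for b c
      unfolding normal_form_def normal_form2_def sym3_def using that \<open>p > 0\<close>
      by - (rule disjI2, rule disjI1, rule exI[of _ p], rule exI[of _ "-b"], rule exI[of _ c], simp)
    from qr consider "q < 0" "r > 0" | "r < 0" "q > 0" by (auto simp: mult_less_0_iff)
    then show ?thesis
    proof cases
      case 1
      then show ?thesis using * by (simp add: reducible_normal_form)
    next
      case 2
      then show ?thesis using * swap unfolding reducible_def by blast
    qed
  qed
qed

lemma mat3_scaleR: "k *\<^sub>R mat3 a b c d e f g h i =
   mat3 (k*a) (k*b) (k*c) (k*d) (k*e) (k*f) (k*g) (k*h) (k*i)"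
  by (simp add: mat3_eq_iff)

text \<open>
  In forms (3) and (4) the operator has eigenvalues \<open>u\<close> and \<open>Z \<plusminus> \<i> Y\<close>; comparison of
  \<open>4 (\<alpha> \<plusminus> \<i> \<beta>) / (a\<^sup>2 (\<alpha>\<^sup>2 + \<beta>\<^sup>2)) = Z \<plusminus> \<i> Y\<close> and \<open>4 / (\<alpha>\<^sup>2 + \<beta>\<^sup>2) = u\<close> gives the parameters.
\<close>

context
  fixes Y Z u R s \<alpha> \<beta> a :: real
  assumes Y: "Y > 0" and Z: "Z \<noteq> 0" and u: "u > 0"
  defines "R \<equiv> sqrt (Y^2 + Z^2)" and "s \<equiv> 2 / sqrt u"
    and "\<alpha> \<equiv> Z * s / R" and "\<beta> \<equiv> Y * s / R" and "a \<equiv> 2 / sqrt (s * R)"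
begin

text \<open>\<open>s\<close> and \<open>R\<close> are the moduli of \<alpha> + \<i> \<beta> and
  \<open>Z + \<i> Y\<close>; in terms of them the square roots in forms (3) and (4)
  disappear.\<close>

lemma complex_params:
  "R > 0" "R^2 = Y^2 + Z^2" "s > 0" "s^2 = 4 / u" "a^2 = 4 / (s * R)" "a \<noteq> 0" "\<beta> > 0"
  "sqrt (\<alpha>^2 + \<beta>^2) = s" "4 / (a^2 * \<alpha> * sqrt (\<alpha>^2 + \<beta>^2)) = R^2 / (Z * s)"
  "R^2 / (Z * s) * (a^2 * \<alpha> / s) = u"
  "R^2 / (Z * s) * ((\<beta>^2 - \<alpha>^2) / s) = (Y^2 - Z^2) / Z"
  "R^2 / (Z * s) * ((\<alpha>^2 - \<beta>^2) / s) = (Z^2 - Y^2) / Z"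
  "R^2 / (Z * s) * \<beta> = R * Y / Z"
  "R^2 / (Z * s) * s = R^2 / Z"
proof -
  show R: "R > 0" using Y unfolding R_def by (simp add: add_pos_nonneg)
  show R2: "R^2 = Y^2 + Z^2" by (simp add: R_def)
  show s: "s > 0" using u by (simp add: s_def)
  show s2: "s^2 = 4 / u" using u by (simp add: s_def power_divide)
  show a2: "a^2 = 4 / (s * R)" using s R by (simp add: a_def power_divide)
  show "a \<noteq> 0" "\<beta> > 0" using R s Y by (simp_all add: a_def \<beta>_def)
  have "\<alpha>^2 + \<beta>^2 = s^2 * ((Y^2 + Z^2) / R^2)"
    by (simp add: \<alpha>_def \<beta>_def power_divide power_mult_distrib algebra_simps add_divide_distrib)
  moreover have "(Y^2 + Z^2) / R^2 = 1" using R R2[symmetric] by simp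
  ultimately have "\<alpha>^2 + \<beta>^2 = s^2" by simp
  then show sq: "sqrt (\<alpha>^2 + \<beta>^2) = s" using s by simp
  show "4 / (a^2 * \<alpha> * sqrt (\<alpha>^2 + \<beta>^2)) = R^2 / (Z * s)"
    unfolding sq a2 unfolding \<alpha>_def using R s Z by (simp add: field_simps power2_eq_square)
  have "R^2 / (Z * s) * (a^2 * \<alpha> / s) = 4 / s^2"
    unfolding a2 \<alpha>_def using R s Z by (simp add: field_simps power2_eq_square)
  then show "R^2 / (Z * s) * (a^2 * \<alpha> / s) = u" using s2 u by simp
  show "R^2 / (Z * s) * ((\<beta>^2 - \<alpha>^2) / s) = (Y^2 - Z^2) / Z"
    "R^2 / (Z * s) * ((\<alpha>^2 - \<beta>^2) / s) = (Z^2 - Y^2) / Z"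
    "R^2 / (Z * s) * \<beta> = R * Y / Z"
    "R^2 / (Z * s) * s = R^2 / Z"
    unfolding \<alpha>_def \<beta>_def using R s Z by (simp_all add: field_simps power2_eq_square)
qed

lemma normal_form3_sym3:
  assumes "Z > 0"
  shows "normal_form3 (sym3 ((Y^2 - Z^2) / Z) (R * Y / Z) 0 (R^2 / Z) 0 u)"
proof -
  have "\<alpha> > 0" using assms complex_params by (simp add: \<alpha>_def)
  then show ?thesis
    unfolding normal_form3_def sym3_def using complex_params
    by - (rule exI[of _ a], rule exI[of _ \<alpha>], rule exI[of _ \<beta>],
      simp add: mat3_scaleR del: times_divide_eq_left times_divide_eq_right)
qed

lemma normal_form4_sym3:
  assumes "Z < 0"
  shows "normal_form4 (sym3 (- (R^2 / Z)) 0 (R * Y / Z) u 0 ((Z^2 - Y^2) / Z))"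
proof -
  have "\<alpha> < 0" using assms complex_params by (simp add: \<alpha>_def divide_neg_pos mult_neg_pos)
  then show ?thesis
    unfolding normal_form4_def sym3_def using complex_params
    by - (rule exI[of _ a], rule exI[of _ \<alpha>], rule exI[of _ \<beta>],
      simp add: mat3_scaleR del: times_divide_eq_left times_divide_eq_right)
qed

end

lemma normal_form5_sym3:
  assumes "u > 0" "D > 0"
  shows "normal_form5 (sym3 ((u-D)/4) 0 ((u+D)/4) u 0 ((u-D)/4))"
proof -
  \<comment> \<open>In form (5) the off-diagonal entry plus and minus the diagonal corner is
    \<open>16/(v - U)\<close> and \<open>16/(v + U)\<close>; these must be \<open>u/2\<close> and
    \<open>D/2\<close>.\<close>
  define U v where U_v_def: "U = 16/D - 16/u" "v = 16/D + 16/u"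
  have "v^2 - U^2 = 1024 / (u * D)" using assms
    by (simp add: U_v_def field_simps power2_eq_square)
  then have w: "16 / (v^2 - U^2) = u * D / 64" by simp
  have e: "u * D / 64 * U = (u-D)/4" "u * D / 64 * v = (u+D)/4" "u * D / 64 * (2 * U + 2 * v) = u"
    using assms by (simp_all add: U_v_def field_simps)
  have "v > 0" "-v < U" "U < v" using assms by (simp_all add: U_v_def add_pos_pos)
  then show ?thesis
    unfolding normal_form5_def sym3_def
    by - (rule exI[of _ U], rule exI[of _ v],
      simp add: mat3_scaleR w e del: times_divide_eq_left times_divide_eq_right)
qed

text \<open>In the null basis form (6) has \<open>A = 0\<close>, a Jordan block along
  \<open>n\<close> with eigenvalue \<open>4/(a*b)\<close> beside the eigenvalue \<open>4/b^2\<close>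
  on \<open>X3\<close>.\<close>

lemma normal_form6_nullform:
  assumes "a \<noteq> 0" "b \<noteq> 0"
  shows "normal_form6 (nullform 0 (2/b) (-8/(a*b)) 0 0 (4/b^2))"
  unfolding normal_form6_def sym3_def nullform_def
    using assms
    by - (rule exI[of _ a], rule exI[of _ b],
      simp add: mat3_scaleR mat3_eq_iff field_simps power2_eq_square)

text \<open>Here \<open>C = -2u\<close> gives the triple eigenvalue \<open>4/a^2\<close>, and a
  nonzero \<open>G\<close> a single Jordan block; a rotation about \<open>X1\<close> turns it into
  form (7).\<close>

lemma reducible_form7:
  assumes "a \<noteq> 0"
  shows "reducible (nullform 0 (8/a^4) (-8/a^2) 0 (4 * sqrt 2/a^3) (4/a^2))"
proof -
  define w where "w = sqrt (1 + 2 * a^2)"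
  have "1 + 2 * a^2 > 0" by (simp add: add_pos_nonneg)
  then have w: "w > 0" "w^2 = 1 + 2 * a^2" by (simp_all add: w_def)
  have w3: "(1 + 2 * a^2) powr (3/2) = w^3"
  proof -
    have "(1 + 2 * a^2) powr (3/2) = ((1 + 2 * a^2) powr (1/2)) powr 3"
      by (simp add: powr_powr)
    then show ?thesis using w by (simp add: powr_half_sqrt w_def)
  qed
  define r where "r = sqrt 2"
  have r: "r^2 = 2" by (simp add: r_def)
  \<comment> \<open>The reciprocals \<open>i\<close>, \<open>b\<close> and the root \<open>r\<close>
    make every entry a polynomial, so that \<open>algebra\<close> can compare them.\<close>
  define i b where ib_def: "i = 1/w" "b = 1/a"
  have i: "i^2 * (1 + 2 * a^2) = 1" using w \<open>1 + 2 * a^2 > 0\<close> by (simp add: ib_def power_divide)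
  have wi: "w = (1 + 2 * a^2) * i" using w by (simp add: ib_def field_simps power2_eq_square)
  have b: "a * b = 1" using assms by (simp add: ib_def)
  \<comment> \<open>The (1,3) entry vanishes exactly when \<open>s = r * a * c\<close>; the negative
    \<open>c\<close> makes the (1,2) entry positive.\<close>
  define c s where cs_def: "c = -i" "s = - r * a * i"
  have cs: "c^2 + s^2 = 1" unfolding cs_def using i r by algebra
  define M where "M = (2 / (a^4 * (1 + 2 * a^2))) *\<^sub>R
          mat3 (1 - 4 * a^4) ((1 + 2 * a^2) powr (3/2)) 0
               ((1 + 2 * a^2) powr (3/2)) (4 * a^4 + 6 * a^2 + 1) (2 * sqrt 2 * a^3)
               0 (2 * sqrt 2 * a^3) (4 * a^4)"
  have k: "2 / (a^4 * (1 + 2 * a^2)) = 2 * b^4 * i^2"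
    using w by (simp add: ib_def power_divide)
  define p q x where pqx_def: "p = 2*b^4 - 4*b^2" "q = 2*b^4" "x = 2*b^4 + 4*b^2"
  have N: "nullform 0 (8/a^4) (-8/a^2) 0 (4 * sqrt 2/a^3) (4/a^2) =
     sym3 p (-q) (2*r*b^3) x (-2*r*b^3) (4*b^2)"
    by (simp add: nullform_def pqx_def sym3_def mat3_eq_iff ib_def power_divide r_def)
  have M: "M = sym3 (2*b^4*i^2*(1-4*a^4)) (2*b^4*i^2*w^3) 0 (2*b^4*i^2*(4*a^4+6*a^2+1))
     (2*b^4*i^2*(2*r*a^3)) (2*b^4*i^2*(4*a^4))"
    unfolding M_def w3 k by (simp add: mat3_scaleR sym3_def r_def)
  have "p = 2*b^4*i^2*(1-4*a^4)" "c*(-q) - s*(2*r*b^3) = 2*b^4*i^2*w^3" "s*(-q) + c*(2*r*b^3) = 0"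
    "c^2*x-2*c * s*(-2*r*b^3)+s^2*(4*b^2) = 2*b^4*i^2*(4*a^4+6*a^2+1)"
    "c * s*(x-4*b^2)+(c^2-s^2)*(-2*r*b^3) = 2*b^4*i^2*(2*r*a^3)"
    "s^2*x+2*c * s*(-2*r*b^3)+c^2*(4*b^2) = 2*b^4*i^2*(4*a^4)"
    unfolding pqx_def cs_def wi using i b r by algebra+
  then have "conjugate (nullform 0 (8/a^4) (-8/a^2) 0 (4 * sqrt 2/a^3) (4/a^2)) M"
    using conjugate_rotate_sym3[OF cs, of p "-q" "2*r*b^3" x "-2*r*b^3" "4*b^2"]
    unfolding N M by metis
  moreover have "normal_form M"
    unfolding normal_form_def normal_form7_def M_def using assms by blast
  ultimately show ?thesis by (auto simp: reducible_def)
qed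

section \<open>Metrics for which \<open>X3\<close> splits off\<close>

lemma conjugate_block:
  assumes "A * A' > 0" "A * B = A' * B'"
  shows "conjugate (nullform A B C 0 0 u) (nullform A' B' C 0 0 u)"
proof -
  have pos: "A'/A > 0" and nz: "A \<noteq> 0" "A' \<noteq> 0"
    using assms(1) by (auto simp: zero_less_divide_iff zero_less_mult_iff)
  \<comment> \<open>A boost scales \<open>A\<close> and \<open>B\<close> by inverse positive
    factors, so only \<open>A * B\<close> and the sign of \<open>A\<close> matter.\<close>
  then have "conjugate (nullform A B C 0 0 u) (nullform (A'/A*A) (B/(A'/A)) C 0 0 u)"
    using conjugate_boost_nullform[of "sqrt (A'/A)" A B C 0 0 u] by simp
  moreover have "B/(A'/A) = B'" using assms(2) nz by (simp add: field_simps)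
  ultimately show ?thesis using nz by simp
qed

lemma reducible_swap_block: "reducible (nullform B A C 0 0 u) \<Longrightarrow> reducible (nullform A B C 0 0 u)"
  using conjugate_half_turn_nullform[of A B C 0 0 u] reducible_conjugate by simp

text \<open>The determinant is a positive multiple of \<open>u\<close> times that of the block on
  \<open>n\<close>, \<open>m\<close>. For \<open>u < 0\<close> the block is definite, and a positive
  vector excludes the negative definite one.\<close>

lemma lorentz_block:
  assumes "lorentz (nullform A B C 0 0 u)"
  shows "(A * B - C^2) * u < 0" "u < 0 \<Longrightarrow> A > 0"
proof -
  have "4 * det (nullform A B C 0 0 u) = (A * B - C^2) * u"
    by (simp add: nullform_def sym3_def det_mat3 field_simps power2_eq_square)
  then show d: "(A * B - C^2) * u < 0" using assms by (simp add: lorentz_def)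
  assume "u < 0"
  then have "A * B - C^2 > 0" using d by (simp add: mult_less_0_iff)
  then have nz: "A * B > 0" by (smt (verit) zero_le_power2)
  show "A > 0"
  proof (rule ccontr)
    assume "\<not> A > 0"
    then have "A < 0" using nz by (cases "A = 0") auto
    obtain v where v: "v \<bullet> (nullform A B C 0 0 u *v v) > 0" using assms by (auto simp: lorentz_def)
    define x y z where "x = (v$1 + v$2)/2" "y = (v$1 - v$2)/2" "z = v$3"
    have "v \<bullet> (nullform A B C 0 0 u *v v) = A*x^2 + 2*C*x*y + B*y^2 + u*z^2"
      unfolding nullform_def sym3_quadratic x_y_z_def by (simp add: field_simps power2_eq_square)
    moreover have "A * (A*x^2 + 2*C*x*y + B*y^2) = (A*x+C*y)^2 + (A*B-C^2)*y^2"
      by (simp add: field_simps power2_eq_square)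
    then have "A * (A*x^2 + 2*C*x*y + B*y^2) \<ge> 0" using \<open>A * B - C^2 > 0\<close> by simp
    then have "A*x^2 + 2*C*x*y + B*y^2 \<le> 0" using \<open>A < 0\<close> by (simp add: zero_le_mult_iff)
    moreover have "u * z^2 \<le> 0" using \<open>u < 0\<close> by (simp add: mult_nonpos_nonneg)
    ultimately show False using v by linarith
  qed
qed


text \<open>As \<open>n\<close> and \<open>m\<close> pair to \<open>-2\<close> under
  \<open>killing\<close>, the block has eigenvalues \<open>-C/2\<close> plus or minus half a square
  root of \<open>A * B\<close>, that is \<open>Z \<plusminus> \<i> Y\<close>. The sign of
  \<open>Z\<close> selects form (3), (4) or (5).\<close>

lemma reducible_complex_block:
  assumes "A * B < 0" "u > 0"
  shows "reducible (nullform A B C 0 0 u)"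
proof -
  define Y Z R where "Y = sqrt (- A * B) / 2" "Z = - C / 2" and R_def: "R = sqrt (Y^2 + Z^2)"
  have Y: "Y > 0" "4 * Y^2 = - A * B" using assms by (simp_all add: Y_Z_def power_divide)
  have C: "C = - 2 * Z" by (simp add: Y_Z_def)
  have R: "R^2 = Y^2 + Z^2" by (simp add: R_def)
  have Rpos: "R > 0" using Y(1) by (simp add: R_def add_pos_nonneg)
  have swap: ?thesis if "\<And>A B. A * B = - 4 * Y^2 \<Longrightarrow> A > 0 \<Longrightarrow> reducible (nullform A B C 0 0 u)"
  proof (cases "A > 0")
    case True
    then show ?thesis using that Y by simp
  next
    case False
    then have "B > 0" using assms by (auto simp: mult_less_0_iff)
    then show ?thesis using that[of B A] Y reducible_swap_block by (simp add: mult.commute)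
  qed
  \<comment> \<open>It remains to exhibit, in each form, a block with positive first value and
    product \<open>- 4 * Y^2\<close>.\<close>
  have match: "reducible (nullform A B C 0 0 u)"
    if "reducible (nullform A' B' C 0 0 u)" "A > 0" "A' > 0" "A * B = - 4 * Y^2" "A' * B' = - 4 * Y^2" for A B A' B'
    using that conjugate_block[of A A' B B' C u] reducible_conjugate by simp
  consider "Z > 0" | "Z < 0" | "Z = 0" by linarith
  then show ?thesis
  proof cases
    case 1
    define A' B' where "A' = 2*Y*(Y+R)/Z" "B' = 2*Y*(Y-R)/Z"
    have "sym3 ((Y^2 - Z^2) / Z) (R * Y / Z) 0 (R^2 / Z) 0 u = nullform A' B' C 0 0 u"
    proof -
      have "(Y^2 - Z^2) / Z + 2 * (R * Y / Z) + (Y^2 + Z^2) / Z = A'"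
        "(Y^2 - Z^2) / Z - 2 * (R * Y / Z) + (Y^2 + Z^2) / Z = B'"
        "(Y^2 - Z^2) / Z - (Y^2 + Z^2) / Z = C"
        unfolding C A'_B'_def using 1 by (simp_all add: field_simps power2_eq_square)
      then show ?thesis unfolding sym3_eq_nullform R by simp
    qed
    then have "reducible (nullform A' B' C 0 0 u)"
      using normal_form3_sym3[OF Y(1) _ assms(2) 1] 1
      by (simp add: reducible_normal_form normal_form_def R_def)
    moreover have "A' * B' = 4 * Y^2 * (Y^2 - R^2) / Z^2"
      using 1 by (simp add: A'_B'_def field_simps power2_eq_square)
    then have "A' * B' = - 4 * Y^2" using 1 R by simp
    moreover have "A' > 0" using 1 Y(1) Rpos by (simp add: A'_B'_def)
    ultimately show ?thesis using swap match by metis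
  next
    case 2
    \<comment> \<open>A quarter turn of form (4) has the values \<open>B'\<close> on
      \<open>n\<close> and \<open>A'\<close> on \<open>m\<close>; as \<open>B' < 0 < A'\<close>, a
      half turn must follow.\<close>
    define A' B' where "A' = -2*Y*(Y+R)/Z" "B' = 2*Y*(R-Y)/Z"
    have "nullform B' A' C 0 0 u = sym3 (- (R^2 / Z)) (R * Y / Z) 0 ((Z^2 - Y^2) / Z) 0 u"
    proof -
      have "- ((Y^2 + Z^2) / Z) + 2 * (R * Y / Z) + (Z^2 - Y^2) / Z = B'"
        "- ((Y^2 + Z^2) / Z) - 2 * (R * Y / Z) + (Z^2 - Y^2) / Z = A'"
        "- ((Y^2 + Z^2) / Z) - (Z^2 - Y^2) / Z = C"
        unfolding C A'_B'_def using 2 by (simp_all add: field_simps power2_eq_square)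
      then show ?thesis unfolding sym3_eq_nullform R by simp
    qed
    then have "conjugate (nullform B' A' C 0 0 u) (sym3 (- (R^2 / Z)) 0 (R * Y / Z) u 0 ((Z^2 - Y^2) / Z))"
      using conjugate_quarter_turn by (metis minus_zero)
    then have "reducible (nullform B' A' C 0 0 u)"
      using normal_form4_sym3[OF Y(1) _ assms(2) 2] 2
      unfolding reducible_def normal_form_def R_def by auto
    then have "reducible (nullform A' B' C 0 0 u)" by (rule reducible_swap_block)
    moreover have "A' * B' = 4 * Y^2 * (Y^2 - R^2) / Z^2"
      using 2 by (simp add: A'_B'_def field_simps power2_eq_square)
    then have "A' * B' = - 4 * Y^2" using 2 R by simp
    moreover have "A' > 0" using 2 Y(1) Rpos unfolding A'_B'_def by (intro divide_neg_neg) (simp_all add: mult_neg_pos)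
    ultimately show ?thesis using swap match by metis
  next
    case 3
    \<comment> \<open>Form (5) forces the value on \<open>n\<close> to equal \<open>u\<close>; the
      product then determines \<open>D\<close>.\<close>
    define D where "D = 4 * Y^2 / u"
    have D: "D > 0" "u * (-D) = - 4 * Y^2" using Y(1) assms(2) by (simp_all add: D_def)
    have "nullform u (-D) C 0 0 u = sym3 ((u-D)/4) ((u+D)/4) 0 ((u-D)/4) 0 u"
      unfolding sym3_eq_nullform C 3 by (simp add: field_simps)
    then have "conjugate (nullform u (-D) C 0 0 u) (sym3 ((u-D)/4) 0 ((u+D)/4) u 0 ((u-D)/4))"
      using conjugate_quarter_turn by (metis minus_zero)
    then have "reducible (nullform u (-D) C 0 0 u)"
      using normal_form5_sym3[OF assms(2) D(1)] unfolding reducible_def normal_form_def by auto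
    then show ?thesis using swap match D assms(2) by metis
  qed
qed

text \<open>For \<open>A * B > 0\<close> a boost makes the matrix diagonal, for
  \<open>A * B < 0\<close> there is a complex pair, and exactly one zero among \<open>A\<close>,
  \<open>B\<close> means a rank two Jordan block, form (6).\<close>

lemma reducible_block:
  assumes "lorentz (nullform A B C 0 0 u)"
  shows "reducible (nullform A B C 0 0 u)"
proof -
  have *: "(A * B - C^2) * u < 0" using lorentz_block[OF assms] by simp
  have diag: "reducible (nullform D D C 0 0 u)" if "lorentz (nullform D D C 0 0 u)" for D
    using reducible_diagonal that by (simp add: nullform_def)
  have jordan: "reducible (nullform 0 B C 0 0 u)" if "B \<noteq> 0" "C^2*u > 0" for B
  proof -
    have "u > 0" "C \<noteq> 0" using that by (auto simp: zero_less_mult_iff)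
    \<comment> \<open>Solves \<open>4/b^2 = u\<close> with the sign of \<open>B\<close>, then
      \<open>-8/(a*b) = C\<close>, the data of form (6).\<close>
    define b a where "b = sgn B * (2 / sqrt u)" "a = - 8 / (b * C)"
    have b2: "b^2 = 4 / u" using \<open>u > 0\<close> that
      by (simp add: b_a_def power_mult_distrib power_divide sgn_if)
    have bB: "b * B > 0" using \<open>u > 0\<close> that by (simp add: b_a_def sgn_if field_simps)
    then have nz: "a \<noteq> 0" "b \<noteq> 0" using \<open>C \<noteq> 0\<close> by (auto simp: b_a_def)
    have C: "-8 / (a * b) = C" using \<open>C \<noteq> 0\<close> nz(2) by (simp add: b_a_def(2))
    have u: "4 / b^2 = u" using b2 \<open>u > 0\<close> by simp
    have "reducible (nullform 0 (2/b) C 0 0 u)"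
      using normal_form6_nullform[OF nz] unfolding C u
      by (simp add: reducible_normal_form normal_form_def)
    then have "reducible (nullform (2/b) 0 C 0 0 u)" by (rule reducible_swap_block)
    moreover have "B * (2/b) > 0" using bB by (auto simp: zero_less_divide_iff zero_less_mult_iff)
    ultimately have "reducible (nullform B 0 C 0 0 u)"
      using conjugate_block[of B "2/b" 0 0 C u] reducible_conjugate by simp
    then show ?thesis by (rule reducible_swap_block)
  qed
  consider "A * B > 0" | "A * B < 0" | "A = 0" "B = 0" | "A = 0" "B \<noteq> 0" | "A \<noteq> 0" "B = 0"
    by (metis linorder_neqE_linordered_idom mult_eq_0_iff)
  then show ?thesis
  proof cases
    case 1
    \<comment> \<open>Boosting \<open>A\<close> and \<open>B\<close> to a common value
      \<open>D\<close> removes the (1,2) entry.\<close>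
    define D where "D = sgn A * sqrt (A * B)"
    have "A \<noteq> 0" using 1 by auto
    have "A * D = \<bar>A\<bar> * sqrt (A * B)" by (simp add: D_def sgn_if)
    then have "A * D > 0" using 1 \<open>A \<noteq> 0\<close> by simp
    moreover have "D * D = (sgn A)^2 * (sqrt (A * B))^2"
      unfolding D_def by (simp only: power2_eq_square mult.assoc mult.left_commute)
    then have "A * B = D * D" using 1 \<open>A \<noteq> 0\<close> by (simp add: sgn_if)
    ultimately have *: "conjugate (nullform A B C 0 0 u) (nullform D D C 0 0 u)" by (rule conjugate_block)
    then have "reducible (nullform D D C 0 0 u)"
      using diag lorentz_conjugate assms by blast
    then show ?thesis using * reducible_conjugate by blast
  next
    case 2
    then have "A * B - C^2 < 0" by (smt (verit) zero_le_power2)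
    then have "u > 0" using * by (simp add: mult_less_0_iff)
    then show ?thesis using 2 reducible_complex_block by blast
  next
    case 3
    then show ?thesis using diag assms by blast
  next
    case 4
    then show ?thesis using jordan * by simp
  next
    case 5
    then have "reducible (nullform 0 A C 0 0 u)" using jordan * by simp
    then show ?thesis using 5 reducible_swap_block by blast
  qed
qed

text \<open>With \<open>n\<close> an eigenvector, a shear kills \<open>G\<close> unless the
  eigenvalues \<open>u\<close> and \<open>-C/2\<close> coincide. If they do and \<open>G\<close> is
  nonzero, the operator is a single Jordan block, brought to form (7).\<close>

lemma reducible_null_eigenvector:
  assumes "lorentz (nullform 0 B C 0 G u)"
  shows "reducible (nullform 0 B C 0 G u)"
proof -
  have "4 * det (nullform 0 B C 0 G u) = - (C^2) * u"
    by (simp add: nullform_def sym3_def det_mat3 field_simps power2_eq_square)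
  then have "C^2 * u > 0" using assms by (simp add: lorentz_def)
  then have u: "u > 0" and C: "C \<noteq> 0" by (auto simp: zero_less_mult_iff)
  consider "2*u+C \<noteq> 0" | "2*u+C = 0" "G = 0" | "2*u+C = 0" "G \<noteq> 0" by blast
  then show ?thesis
  proof cases
    case 1
    define x where "x = - G / (2*u+C)"
    have "G + x * (2*u+C) = 0" using 1 by (simp add: x_def)
    then have *: "conjugate (nullform 0 B C 0 G u) (nullform 0 (B + 4*x*G + 2*x^2*(2*u+C)) C 0 0 u)"
      using conjugate_shear_nullform[of B C G u x] by simp
    then show ?thesis using reducible_block lorentz_conjugate[OF assms] reducible_conjugate by blast
  next
    case 2
    then show ?thesis using reducible_block assms by simp
  next
    case 3
    \<comment> \<open>Taking the sign of \<open>G\<close> makes the boost factor \<open>k\<close>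
      positive.\<close>
    define a where "a = sgn G * (2 / sqrt u)"
    have a2: "a^2 = 4 / u" using u 3
      by (simp add: a_def power_mult_distrib power_divide sgn_if)
    have aG: "a * G > 0" using u 3 by (simp add: a_def sgn_if field_simps)
    then have a: "a \<noteq> 0" by auto
    define k where "k = G * a^3 / (4 * sqrt 2)"
    have "a^3 * G = a^2 * (a * G)" by (simp add: power2_eq_square power3_eq_cube)
    moreover have "a^2 * (a * G) > 0" using a by (intro mult_pos_pos[OF _ aG]) simp
    ultimately have "a^3 * G > 0" by (simp only:)
    then have k: "k > 0" by (simp add: k_def mult.commute)
    have u': "4/a^2 = u" "-8/a^2 = C" using a2 u 3 by simp_all
    have G: "G / k = 4 * sqrt 2 / a^3" using 3 a by (simp add: k_def)
    \<comment> \<open>For \<open>2*u+C = 0\<close> a shear keeps \<open>G\<close> and adds a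
      multiple of it to \<open>B\<close>, so \<open>B\<close> can be given its value in
      \<open>reducible_form7\<close>.\<close>
    define x where "x = (8/a^4 - B/k^2) / (4 * (G/k))"
    have "conjugate (nullform 0 B C 0 G u) (nullform 0 (B/k^2) C 0 (G/k) u)"
      using conjugate_boost_nullform[OF k, of 0 B C 0 G u] by simp
    also have "conjugate \<dots> (nullform 0 (8/a^4) C 0 (G/k) u)"
      using conjugate_shear_nullform[of "B/k^2" C "G/k" u x] 3 k by (simp add: x_def)
    finally show ?thesis
      using reducible_form7[OF a] reducible_conjugate unfolding u' G by blast
  qed
qed

text \<open>Half the polar angle of \<open>((x0 - z)/2, y)\<close> is, up to sign, the rotation
  angle that diagonalizes the block on \<open>X2\<close>, \<open>X3\<close>.\<close>

lemma conjugate_rotate_diagonal: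
  "\<exists>x z'. conjugate (sym3 p 0 0 x0 y z) (sym3 p 0 0 x 0 z')"
proof -
  obtain r a where ra: "(x0 - z) / 2 = r * cos a" "y = r * sin a"
    using polar_Ex by metis
  define c s where "c = cos (- a / 2)" "s = sin (- a / 2)"
  have cs: "c^2 + s^2 = 1" by (simp add: c_s_def)
  have "c^2 - s^2 = cos a" "2 * c * s = - sin a"
    using cos_double[of "- a / 2"] sin_double[of "- a / 2"] by (simp_all add: c_s_def)
  moreover have "c * s*(x0 - z)+(c^2-s^2)*y = (2 * c * s) * ((x0 - z)/2) + (c^2-s^2)*y" by simp
  ultimately have "c * s*(x0 - z)+(c^2-s^2)*y = 0"
    unfolding ra by simp
  then show ?thesis using conjugate_rotate_sym3[OF cs, of p 0 0 x0 y z] by auto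
qed


subsection \<open>Reduction along an eigenvector\<close>

text \<open>The eigenvector is \<open>v = a X1 + b X2\<close>. If null, it lies along
  \<open>n\<close> or \<open>m\<close>. If spacelike, a boost takes it to the axis of
  \<open>X2\<close>, and a quarter turn makes \<open>X3\<close> split off. If timelike, a boost
  takes it to the axis of \<open>X1\<close>, and a rotation diagonalizes the complement.\<close>

lemma reducible_planar_eigenvector:
  assumes lor: "lorentz (sym3 p q r x y z)"
    and eig: "p * a + q * b = - l * a" "q * a + x * b = l * b" "r * a + y * b = 0"
    and nz: "a \<noteq> 0 \<or> b \<noteq> 0" and b: "b \<ge> 0"
  shows "reducible (sym3 p q r x y z)"
proof -
  define A B C F G where ABC: "A = p+2*q+x" "B = p-2*q+x" "C = p-x" "F = r+y" "G = r-y"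
  have M: "sym3 p q r x y z = nullform A B C F G z" by (simp add: sym3_eq_nullform ABC)
  \<comment> \<open>The eigenvalue equation paired with \<open>n\<close>, \<open>m\<close> and
    \<open>X3\<close>, where \<open>2v = (a+b) n + (a-b) m\<close>.\<close>
  have null: "(a+b)*A + (a-b)*C = 2*l*(b-a)" "(a+b)*C + (a-b)*B = -2*l*(a+b)" "(a+b)*F + (a-b)*G = 0"
    unfolding ABC using eig by (simp add: algebra_simps; linarith)+
  consider "a = b" "b > 0" | "a = - b" "b > 0" | "\<bar>a\<bar> < b" | "b < \<bar>a\<bar>" using nz b by linarith
  then show ?thesis
  proof cases
    case 1
    then have "A = 0" "F = 0" using null by auto
    then show ?thesis using reducible_null_eigenvector lor unfolding M by simp
  next
    case 2
    then have BG: "B = 0" "G = 0" using null by auto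
    then have "conjugate (nullform A B C F G z) (nullform 0 A C 0 (-F) z)"
      using conjugate_half_turn_nullform[of A B C F G z] by simp
    then show ?thesis using reducible_null_eigenvector lorentz_conjugate[OF lor] reducible_conjugate
      unfolding M by blast
  next
    case 3
    \<comment> \<open>In the basis \<open>k n\<close>, \<open>m/k\<close> the eigenvector must have
      opposite coordinates: \<open>(a+b)/k = k*(b-a)\<close>.\<close>
    define k where "k = sqrt ((a+b)/(b-a))"
    have k: "k > 0" "k^2 = (a+b)/(b-a)" using 3 by (simp_all add: k_def)
    define D H where DH: "D = k^2*A" "H = k*F"
    have t: "k^2 * (b - a) = a + b" using 3 k by simp
    then have "(b - a) * (k^2 * A - (C + 2*l)) = 0" "(b - a) * (k^2 * (C + 2*l) - B) = 0"
      "(b - a) * (k^2 * F - G) = 0"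
      using null by (simp_all add: algebra_simps flip: t)
    then have "k^2 * A = C + 2*l" "B = k^2 * (C + 2*l)" "G = k^2 * F"
      using 3 by auto
    then have "B/k^2 = D" "G/k = H" using k(1) by (simp_all add: DH power2_eq_square)
    then have "conjugate (nullform A B C F G z) (nullform D D C H H z)"
      using conjugate_boost_nullform[OF k(1), of A B C F G z] DH by simp
    also have "nullform D D C H H z = sym3 ((D+C)/2) 0 H ((D-C)/2) 0 z"
      by (simp add: nullform_def sym3_def mat3_eq_iff)
    also have "conjugate \<dots> (sym3 ((D+C)/2) (-H) 0 z 0 ((D-C)/2))"
      using conjugate_quarter_turn[of "(D+C)/2" 0 H "(D-C)/2" 0 z] by simp
    finally have conj: "conjugate (sym3 p q r x y z) (sym3 ((D+C)/2) (-H) 0 z 0 ((D-C)/2))"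
      unfolding M .
    then have "reducible (sym3 ((D+C)/2) (-H) 0 z 0 ((D-C)/2))"
      using lorentz_conjugate[OF lor] unfolding sym3_eq_nullform by (simp add: reducible_block)
    then show ?thesis using conj reducible_conjugate by blast
  next
    case 4
    \<comment> \<open>Now the two coordinates must agree: \<open>(a+b)/k = k*(a-b)\<close>.\<close>
    define k where "k = sqrt ((a+b)/(a-b))"
    have "(a+b)/(a-b) > 0"
      using 4 b by (cases "a \<ge> 0") (auto intro: divide_pos_pos divide_neg_neg)
    then have k: "k > 0" "k^2 = (a+b)/(a-b)" by (simp_all add: k_def)
    define D H where DH: "D = k^2*A" "H = k*F"
    have t: "k^2 * (a - b) = a + b" using 4 k by auto
    then have "(a - b) * (k^2 * A + (C + 2*l)) = 0" "(a - b) * (k^2 * (C + 2*l) + B) = 0"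
      "(a - b) * (k^2 * F + G) = 0"
      using null by (simp_all add: algebra_simps flip: t)
    moreover have "a - b \<noteq> 0" using 4 b by auto
    ultimately have "k^2 * A = - (C + 2*l)" "B = - (k^2 * (C + 2*l))" "G = - (k^2 * F)"
      by (simp_all add: add_eq_0_iff2 add_eq_0_iff)
    then have "B/k^2 = D" "G/k = -H" using k(1) by (simp_all add: DH power2_eq_square)
    then have "conjugate (nullform A B C F G z) (nullform D D C H (-H) z)"
      using conjugate_boost_nullform[OF k(1), of A B C F G z] DH by simp
    also have "nullform D D C H (-H) z = sym3 ((D+C)/2) 0 0 ((D-C)/2) H z"
      by (simp add: nullform_def sym3_def mat3_eq_iff)
    finally have "conjugate (sym3 p q r x y z) (sym3 ((D+C)/2) 0 0 ((D-C)/2) H z)"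
      unfolding M .
    then obtain x' z' where conj: "conjugate (sym3 p q r x y z) (sym3 ((D+C)/2) 0 0 x' 0 z')"
      using conjugate_rotate_diagonal conjugate_trans by blast
    then show ?thesis
      using reducible_diagonal lorentz_conjugate[OF lor] reducible_conjugate by blast
  qed
qed

section \<open>Existence of a real eigenvector\<close>

lemma real_cubic_root:
  fixes a b c :: real
  shows "\<exists>x. x^3 + a*x^2 + b*x + c = 0"
proof -
  \<comment> \<open>Large enough for the leading term to dominate the others at \<open>-N\<close>
    and \<open>N\<close>.\<close>
  define N where "N = 1 + \<bar>a\<bar> + \<bar>b\<bar> + \<bar>c\<bar>"
  have N: "N \<ge> 1" by (simp add: N_def)
  have N2: "N^2 \<ge> N" "N^2 \<ge> 1" using N by (simp_all add: self_le_power)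
  have "\<bar>a\<bar> * N^2 + \<bar>b\<bar> * N + \<bar>c\<bar> \<le> \<bar>a\<bar> * N^2 + \<bar>b\<bar> * N^2 + \<bar>c\<bar> * N^2"
    using N2 N by (intro add_mono mult_left_mono) (auto simp: mult_le_cancel_left1)
  also have "\<dots> = N^3 - N^2" by (simp add: N_def algebra_simps power3_eq_cube power2_eq_square)
  finally have bd: "\<bar>a\<bar> * N^2 + \<bar>b\<bar> * N + \<bar>c\<bar> \<le> N^3" using N2 by linarith
  have "\<bar>a * N^2\<bar> = \<bar>a\<bar> * N^2" "\<bar>b * N\<bar> = \<bar>b\<bar> * N" using N by (simp_all add: abs_mult)
  then have "\<bar>a * N^2\<bar> + \<bar>b * N\<bar> + \<bar>c\<bar> \<le> N^3" using bd by simp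
  note bounds = this abs_ge_self[of "a * N^2"] abs_ge_minus_self[of "a * N^2"] abs_ge_self[of "b * N"]
      abs_ge_minus_self[of "b * N"] abs_ge_self[of c] abs_ge_minus_self[of c]
  have upper: "0 \<le> N^3 + a*N^2 + b*N + c" using bounds by linarith
  have "- (N^3) + a*N^2 - b*N + c \<le> 0" using bounds by linarith
  then have "(-N)^3 + a*(-N)^2 + b*(-N) + c \<le> 0" by simp
  moreover have "\<forall>x. -N \<le> x \<and> x \<le> N \<longrightarrow> isCont (\<lambda>x. x^3 + a*x^2 + b*x + c) x" by simp
  ultimately show ?thesis using upper IVT[of "\<lambda>x. x^3 + a*x^2 + b*x + c" "-N" 0 N] N by auto
qed

text \<open>The cubic is the characteristic polynomial relative to the Killing form.\<close>

lemma killing_eigenvector: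
  fixes p q r x y z :: real
  shows
  "\<exists>l a b c. (a \<noteq> 0 \<or> b \<noteq> 0 \<or> c \<noteq> 0) \<and>
     p * a + q * b + r * c = - l * a \<and> q * a + x * b + y * c = l * b \<and> r * a + y * b + z * c = l * c"
proof -
  obtain l where *: "l^3 + (p-x-z)*l^2 + (x*z - y^2 - p*x - p*z + q^2 + r^2)*l +
     (p*(x*z-y^2) - q*(q*z-r*y) + r*(q*y-r*x)) = 0"
    using real_cubic_root by blast
  define N where "N = sym3 (p+l) q r (x-l) y (z-l)"
  have "det N = 0"
    using * unfolding N_def sym3_def det_mat3 by (simp add: algebra_simps power2_eq_square power3_eq_cube)
  then obtain v where v: "v \<noteq> 0" "N *v v = 0"
    using det_eq_0_rank[of N] matrix_nonfull_linear_equations_eq[of N] by auto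
  have "v$1 \<noteq> 0 \<or> v$2 \<noteq> 0 \<or> v$3 \<noteq> 0" using v(1) by (auto simp: vec_eq_iff forall_3)
  moreover have "(p+l) * v$1 + q * v$2 + r * v$3 = 0" "q * v$1 + (x-l) * v$2 + y * v$3 = 0"
    "r * v$1 + y * v$2 + (z-l) * v$3 = 0"
    using v(2) by (simp_all add: N_def sym3_def vec_eq_iff forall_3 matrix_vector_mult_def sum_3)
  then have "p * v$1 + q * v$2 + r * v$3 = - l * v$1" "q * v$1 + x * v$2 + y * v$3 = l * v$2"
    "r * v$1 + y * v$2 + z * v$3 = l * v$3"
    unfolding distrib_right left_diff_distrib by (linarith, linarith, linarith)
  ultimately show ?thesis by (intro exI[of _ l] exI[of _ "v$1"] exI[of _ "v$2"] exI[of _ "v$3"]) simp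
qed

text \<open>A rotation about \<open>X1\<close> moves the eigenvector into the plane of
  \<open>X1\<close> and \<open>X2\<close>, with coordinate \<open>\<rho> \<ge> 0\<close> along
  \<open>X2\<close>.\<close>

lemma reducible_lorentz:
  assumes "lorentz (sym3 p q r x y z)"
  shows "reducible (sym3 p q r x y z)"
proof -
  obtain l a b d where nz: "a \<noteq> 0 \<or> b \<noteq> 0 \<or> d \<noteq> 0" and
     e: "p * a + q * b + r * d = - l * a" "q * a + x * b + y * d = l * b" "r * a + y * b + z * d = l * d"
    using killing_eigenvector[of p q r x y z] by metis
  define \<rho> where "\<rho> = sqrt (b^2 + d^2)"
  obtain c s where cs: "c^2 + s^2 = 1" "b = c * \<rho>" "d = - s * \<rho>"
  proof (cases "b = 0 \<and> d = 0")
    case True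
    \<comment> \<open>For an eigenvector along \<open>X1\<close> any rotation serves; the identity
      is taken.\<close>
    then show ?thesis using that[of 1 0] by (simp add: \<rho>_def)
  next
    case False
    then have "\<rho> > 0" "\<rho>^2 = b^2 + d^2" by (auto simp: \<rho>_def sum_power2_gt_zero_iff)
    then show ?thesis using that[of "b/\<rho>" "-d/\<rho>"] False
      by (simp add: power_divide flip: add_divide_distrib)
  qed
  have conj: "conjugate (sym3 p q r x y z)
    (sym3 p (c*q-s*r) (s*q+c*r) (c^2*x-2*c * s*y+s^2*z) (c * s*(x-z)+(c^2-s^2)*y) (s^2*x+2*c * s*y+c^2*z))"
    (is "conjugate ?M ?N")
    by (rule conjugate_rotate_sym3[OF cs(1)])
  have "lorentz ?N" using assms lorentz_conjugate conj by blast
  moreover have "p * a + (c*q-s*r) * \<rho> = - l * a"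
    using e(1) unfolding cs(2,3) by (simp add: algebra_simps)
  moreover have "(c*q-s*r) * a + (c^2*x-2*c * s*y+s^2*z) * \<rho>
      = c * (q * a + x * b + y * d) - s * (r * a + y * b + z * d)"
    unfolding cs(2,3) by (simp add: algebra_simps power2_eq_square)
  then have "(c*q-s*r) * a + (c^2*x-2*c * s*y+s^2*z) * \<rho> = l * \<rho> * (c^2 + s^2)"
    unfolding e(2,3) unfolding cs(2,3) by (simp add: algebra_simps power2_eq_square)
  then have "(c*q-s*r) * a + (c^2*x-2*c * s*y+s^2*z) * \<rho> = l * \<rho>"
    unfolding cs(1) by simp
  moreover have "(s*q+c*r) * a + (c * s*(x-z)+(c^2-s^2)*y) * \<rho>
      = s * (q * a + x * b + y * d) + c * (r * a + y * b + z * d)"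
    unfolding cs(2,3) by (simp add: algebra_simps power2_eq_square)
  then have "(s*q+c*r) * a + (c * s*(x-z)+(c^2-s^2)*y) * \<rho> = 0"
    unfolding e(2,3) unfolding cs(2,3) by (simp add: algebra_simps)
  moreover have "a \<noteq> 0 \<or> \<rho> \<noteq> 0" using nz cs by auto
  moreover have "\<rho> \<ge> 0" by (simp add: \<rho>_def)
  ultimately have "reducible ?N" by (rule reducible_planar_eigenvector)
  then show ?thesis using conj reducible_conjugate by blast
qed


subsection \<open>Left invariant metrics\<close>

lemma subspace_sl2: "subspace sl2"
  by (metis span_B0 subspace_span)

lemma B0_in_sl2: "B0 $ i \<in> sl2"
proof -
  have "\<forall>i. B0 $ i \<in> sl2"
    by (simp add: forall_3 B0_def sl2_def X1_def X2_def X3_def trace_def sum_2)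
  then show ?thesis ..
qed

lemma sl2_coordinates:
  assumes "A \<in> sl2"
  obtains c :: "real^3" where "A = (\<Sum>j\<in>UNIV. c $ j *\<^sub>R B0 $ j)"
proof -
  have "A$2$2 = - A$1$1" using assms by (simp add: sl2_def trace_def sum_2)
  then have "A = (\<Sum>j\<in>UNIV. (vector [(A$1$2 - A$2$1) / 2, (A$1$2 + A$2$1) / 2, A$1$1] :: real^3) $ j *\<^sub>R B0 $ j)"
    by (simp add: sum_3 B0_def X1_def X2_def X3_def vec_eq_iff forall_2 field_simps)
  then show ?thesis using that by blast
qed

lemma lorentzian_form_sum:
  assumes b: "lorentzian_form_on V b" and V: "subspace V"
    and fin: "finite I" and f: "\<And>i. i \<in> I \<Longrightarrow> f i \<in> V" and z: "z \<in> V"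
  shows "b (\<Sum>i\<in>I. c i *\<^sub>R f i) z = (\<Sum>i\<in>I. c i * b (f i) z)"
  using fin f
proof (induction I)
  case empty
  have "b (0 *\<^sub>R z) z = 0 * b z z" using b z unfolding lorentzian_form_on_def by blast
  then show ?case by simp
next
  case (insert i I)
  have "(\<Sum>i\<in>I. c i *\<^sub>R f i) \<in> V" "c i *\<^sub>R f i \<in> V"
    using V insert.prems by (auto intro!: subspace_sum subspace_scale)
  then have "b (c i *\<^sub>R f i + (\<Sum>i\<in>I. c i *\<^sub>R f i)) z = b (c i *\<^sub>R f i) z + b (\<Sum>i\<in>I. c i *\<^sub>R f i) z"
    using b z unfolding lorentzian_form_on_def by blast
  moreover have "b (c i *\<^sub>R f i) z = c i * b (f i) z"
    using b z insert.prems unfolding lorentzian_form_on_def by simp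
  ultimately show ?case using insert by simp
qed

definition gram :: "(real^2^2 \<Rightarrow> real^2^2 \<Rightarrow> real) \<Rightarrow> real^2^2^3 \<Rightarrow> real^3^3" where
  "gram b F = (\<chi> i j. b (F $ i) (F $ j))"

lemma gram_congr:
  assumes b: "lorentzian_form_on sl2 b"
    and F: "\<And>i. F $ i = (\<Sum>j\<in>UNIV. S $ i $ j *\<^sub>R B0 $ j)"
  shows "gram b F = congr S (gram b B0)"
proof -
  have sym: "b x y = b y x" if "x \<in> sl2" "y \<in> sl2" for x y
    using b that by (simp add: lorentzian_form_on_def)
  have F_in: "F $ i \<in> sl2" for i
    unfolding F by (intro subspace_sum subspace_scale subspace_sl2 B0_in_sl2)
  have *: "b (F $ i) z = (\<Sum>j\<in>UNIV. S $ i $ j * b (B0 $ j) z)" if "z \<in> sl2" for i z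
    unfolding F using lorentzian_form_sum[OF b subspace_sl2 finite B0_in_sl2 that] .
  have "b (F $ i) (F $ j) = (\<Sum>k\<in>UNIV. \<Sum>l\<in>UNIV. S $ i $ k * (S $ j $ l * b (B0 $ k) (B0 $ l)))" for i j
  proof -
    \<comment> \<open>Symmetry turns linearity in the first argument into linearity in the
      second.\<close>
    have "b (F $ i) (F $ j) = (\<Sum>k\<in>UNIV. S $ i $ k * b (F $ j) (B0 $ k))"
      unfolding *[OF F_in] by (simp only: sym[OF B0_in_sl2 F_in])
    also have "\<dots> = (\<Sum>k\<in>UNIV. \<Sum>l\<in>UNIV. S $ i $ k * (S $ j $ l * b (B0 $ k) (B0 $ l)))"
      unfolding *[OF B0_in_sl2] sum_distrib_left
      by (intro sum.cong refl) (simp add: sym[OF B0_in_sl2 B0_in_sl2])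
    finally show ?thesis .
  qed
  then show ?thesis
    by (simp add: gram_def congr_def vec_eq_iff matrix_matrix_mult_def transpose_def sum_3 algebra_simps)
qed

text \<open>When the rows of \<open>S\<close> are the coordinates of an orthonormal basis,
  \<open>congr S\<close> yields \<open>diag(1,1,-1)\<close>; this fixes the sign of the determinant,
  and the first basis vector is positive.\<close>

lemma lorentz_gram:
  assumes b: "lorentzian_form_on sl2 b"
  shows "lorentz (gram b B0)"
proof -
  obtain e1 e2 e3 where span: "span {e1, e2, e3} = sl2" and
    e: "b e1 e1 = 1" "b e2 e2 = 1" "b e3 e3 = -1" "b e1 e2 = 0" "b e1 e3 = 0" "b e2 e3 = 0"
    using b unfolding lorentzian_form_on_def by metis
  have e_in: "e1 \<in> sl2" "e2 \<in> sl2" "e3 \<in> sl2" using span_superset[of "{e1, e2, e3}"] unfolding span by simp_all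
  define F :: "real^2^2^3" where "F = vector [e1, e2, e3]"
  have "\<forall>i. F $ i \<in> sl2" using e_in by (simp add: forall_3 F_def)
  then have "\<forall>i. \<exists>c::real^3. F $ i = (\<Sum>j\<in>UNIV. c $ j *\<^sub>R B0 $ j)" by (metis sl2_coordinates)
  then obtain T :: "3 \<Rightarrow> real^3" where T: "\<And>i. F $ i = (\<Sum>j\<in>UNIV. T i $ j *\<^sub>R B0 $ j)" by metis
  define S :: "real^3^3" where "S = (\<chi> i. T i)"
  have "gram b F = congr S (gram b B0)" using T by (intro gram_congr[OF b]) (simp add: S_def)
  moreover have "b y x = b x y" if "x \<in> sl2" "y \<in> sl2" for x y
    using b that by (simp add: lorentzian_form_on_def)
  then have "gram b F = mat3 1 0 0 0 1 0 0 0 (-1)"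
    using e e_in by (simp add: gram_def mat3_eq_iff F_def)
  ultimately have J: "congr S (gram b B0) = mat3 1 0 0 0 1 0 0 0 (-1)" by simp
  then have "(det S)^2 * det (gram b B0) = -1" by (simp add: det_mat3 flip: det_congr)
  then have "det (gram b B0) < 0"
    using mult_nonneg_nonneg[OF zero_le_power2[of "det S"], of "det (gram b B0)"] by linarith
  moreover have "row 1 S \<bullet> (gram b B0 *v row 1 S) = congr S (gram b B0) $ 1 $ 1"
    by (simp add: congr_def row_def inner_vec_def matrix_vector_mult_def matrix_matrix_mult_def
       transpose_def sum_3 algebra_simps)
  then have "row 1 S \<bullet> (gram b B0 *v row 1 S) > 0" by (simp add: J)
  ultimately show ?thesis by (auto simp: lorentz_def)
qed

lemma lorentzian_form_normal_form:
  assumes b: "lorentzian_form_on sl2 b"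
  shows "\<exists>P. det P = 1 \<and> normal_form (gram b (\<chi> i. P ** B0 $ i ** adj2 P))"
proof -
  define M where "M = gram b B0"
  have "b y x = b x y" if "x \<in> sl2" "y \<in> sl2" for x y
    using b that by (simp add: lorentzian_form_on_def)
  then have M: "M = sym3 (M$1$1) (M$1$2) (M$1$3) (M$2$2) (M$2$3) (M$3$3)"
    unfolding sym3_def mat3_eq_iff by (simp add: M_def gram_def B0_in_sl2)
  then have "reducible M" using lorentz_gram[OF b] reducible_lorentz M_def by metis
  then obtain P where "det P = 1" "normal_form (congr (Ad_mat P) M)"
    by (auto simp: reducible_def conjugate_def)
  moreover have "gram b (\<chi> i. P ** B0 $ i ** adj2 P) = congr (Ad_mat P) M"
    unfolding M_def by (intro gram_congr[OF b]) (simp add: Ad_mat_conj)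
  ultimately show ?thesis by auto
qed

text \<open>The map \<open>f'\<close> carries an orthonormal basis of \<open>V\<close> to one of
  \<open>W\<close>, since \<open>f\<close> undoes \<open>f'\<close>.\<close>

lemma lorentzian_form_on_pullback:
  assumes b: "lorentzian_form_on V b" and lin: "linear f" "linear f'"
    and im: "f ` W \<subseteq> V" "f' ` V = W" and inv: "\<And>x. f (f' x) = x"
  shows "lorentzian_form_on W (\<lambda>x y. b (f x) (f y))"
proof -
  obtain e1 e2 e3 where e: "span {e1, e2, e3} = V"
    "b e1 e1 = 1" "b e2 e2 = 1" "b e3 e3 = -1" "b e1 e2 = 0" "b e1 e3 = 0" "b e2 e3 = 0"
    using b unfolding lorentzian_form_on_def by metis
  have "span {f' e1, f' e2, f' e3} = W"
    using linear_span_image[OF lin(2), of "{e1, e2, e3}"] im e(1) by simp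
  then have "\<exists>e1 e2 e3. span {e1, e2, e3} = W \<and>
        b (f e1) (f e1) = 1 \<and> b (f e2) (f e2) = 1 \<and> b (f e3) (f e3) = -1 \<and>
        b (f e1) (f e2) = 0 \<and> b (f e1) (f e3) = 0 \<and> b (f e2) (f e3) = 0"
    using e(2-) inv by metis
  moreover have "f x \<in> V" if "x \<in> W" for x using im that by blast
  ultimately show ?thesis
    using b lin(1) unfolding lorentzian_form_on_def by (simp add: linear_add linear_scale)
qed

lemma linear_matrix_conj: "linear (\<lambda>A::real^2^2. P ** A ** Q)"
  by (rule linearI) (simp_all add: matrix_matrix_mult_def vec_eq_iff sum_2 algebra_simps)

lemma sl2_conj:
  assumes "A \<in> sl2" "Q ** P = mat 1"
  shows "P ** A ** Q \<in> sl2"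
proof -
  have "trace (P ** A ** Q) = trace (Q ** P ** A)" by (metis matrix_mul_assoc trace_mul_sym)
  then show ?thesis using assms by (simp add: sl2_def)
qed

section \<open>Inner automorphisms of the covering group\<close>

context
  fixes G :: "('g::real_normed_vector) monoid" and p :: "'g \<Rightarrow> real^2^2"
  assumes cover: "universal_covering_SL2 G p"
begin

interpretation group G
  using cover by (simp add: universal_covering_SL2_def)

lemma projection_mult: "x \<in> carrier G \<Longrightarrow> y \<in> carrier G \<Longrightarrow> p (x \<otimes>\<^bsub>G\<^esub> y) = p x ** p y"
  using cover by (simp add: universal_covering_SL2_def hom_def SL2_def)

lemma projection_det: "x \<in> carrier G \<Longrightarrow> det (p x) = 1"
  using cover by (auto simp: universal_covering_SL2_def hom_def SL2_def)

lemma projection_one: "p \<one>\<^bsub>G\<^esub> = mat 1"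
proof -
  \<comment> \<open>An invertible idempotent is the identity.\<close>
  have "p \<one>\<^bsub>G\<^esub> ** p \<one>\<^bsub>G\<^esub> = p \<one>\<^bsub>G\<^esub>" using projection_mult[of "\<one>\<^bsub>G\<^esub>" "\<one>\<^bsub>G\<^esub>"] by simp
  moreover have "adj2 (p \<one>\<^bsub>G\<^esub>) ** p \<one>\<^bsub>G\<^esub> = mat 1" by (simp add: adj2_mult projection_det)
  ultimately show ?thesis by (metis matrix_mul_assoc matrix_mul_lid)
qed

lemma projection_inv:
  assumes "x \<in> carrier G"
  shows "p x ** p (inv\<^bsub>G\<^esub> x) = mat 1" "p (inv\<^bsub>G\<^esub> x) ** p x = mat 1" "p (inv\<^bsub>G\<^esub> x) = adj2 (p x)"
proof -
  show 1: "p x ** p (inv\<^bsub>G\<^esub> x) = mat 1"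
    using assms projection_mult[of x "inv\<^bsub>G\<^esub> x"] by (simp add: projection_one)
  show "p (inv\<^bsub>G\<^esub> x) ** p x = mat 1"
    using assms projection_mult[of "inv\<^bsub>G\<^esub> x" x] by (simp add: projection_one)
  have "adj2 (p x) ** p x = mat 1" using assms by (simp add: adj2_mult projection_det)
  then show "p (inv\<^bsub>G\<^esub> x) = adj2 (p x)" using 1 by (metis matrix_mul_assoc matrix_mul_lid matrix_mul_rid)
qed

lemma projection_surj:
  assumes "det P = 1"
  obtains k where "k \<in> carrier G" "p k = P"
proof -
  have "p ` carrier G = carrier SL2"
    using cover by (simp add: universal_covering_SL2_def covering_space_def)
  then have "P \<in> p ` carrier G" using assms by (simp add: SL2_def)
  then show ?thesis using that by blast
qed

lemma tangent_at_conj: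
  assumes "k \<in> carrier G" "g \<in> carrier G"
  shows "(\<lambda>A. p k ** A ** p (inv\<^bsub>G\<^esub> k)) ` tangent_at p g \<subseteq> tangent_at p (k \<otimes>\<^bsub>G\<^esub> g \<otimes>\<^bsub>G\<^esub> inv\<^bsub>G\<^esub> k)"
proof (clarsimp simp: tangent_at_def)
  fix A assume "A \<in> sl2"
  then have "p k ** A ** p (inv\<^bsub>G\<^esub> k) \<in> sl2" using sl2_conj projection_inv assms by simp
  moreover have "p k ** (p g ** A) ** p (inv\<^bsub>G\<^esub> k)
    = p (k \<otimes>\<^bsub>G\<^esub> g \<otimes>\<^bsub>G\<^esub> inv\<^bsub>G\<^esub> k) ** (p k ** A ** p (inv\<^bsub>G\<^esub> k))"
    using assms projection_inv[OF assms(1)]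
    by (simp add: projection_mult) (metis matrix_mul_assoc matrix_mul_rid)
  ultimately show "p k ** (p g ** A) ** p (inv\<^bsub>G\<^esub> k) \<in>
     (\<lambda>A. p (k \<otimes>\<^bsub>G\<^esub> g \<otimes>\<^bsub>G\<^esub> inv\<^bsub>G\<^esub> k) ** A) ` sl2" by (rule rev_image_eqI)
qed

lemma continuous_on_translations:
  assumes "a \<in> carrier G" "b \<in> carrier G"
  shows "continuous_on (carrier G) (\<lambda>x. a \<otimes>\<^bsub>G\<^esub> x \<otimes>\<^bsub>G\<^esub> b)"
proof -
  have mult: "continuous_on (carrier G \<times> carrier G) (\<lambda>(x, y). x \<otimes>\<^bsub>G\<^esub> y)"
    using cover by (simp add: universal_covering_SL2_def)
  have "continuous_on (carrier G) (\<lambda>x. a \<otimes>\<^bsub>G\<^esub> x)"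
    using assms by (intro continuous_on_compose2[OF mult, of _ "\<lambda>x. (a, x)", simplified] continuous_intros) auto
  then show ?thesis
    using assms by (intro continuous_on_compose2[OF mult, of _ "\<lambda>x. (a \<otimes>\<^bsub>G\<^esub> x, b)", simplified] continuous_intros) auto
qed

lemma inv_cancel:
  assumes "x \<in> carrier G" "y \<in> carrier G"
  shows "x \<otimes>\<^bsub>G\<^esub> (inv\<^bsub>G\<^esub> x \<otimes>\<^bsub>G\<^esub> y) = y" "inv\<^bsub>G\<^esub> x \<otimes>\<^bsub>G\<^esub> (x \<otimes>\<^bsub>G\<^esub> y) = y"
  using assms by (simp_all flip: m_assoc)

lemma conj_cancel:
  assumes "k \<in> carrier G" "g \<in> carrier G"
  shows "k \<otimes>\<^bsub>G\<^esub> (inv\<^bsub>G\<^esub> k \<otimes>\<^bsub>G\<^esub> g \<otimes>\<^bsub>G\<^esub> k) \<otimes>\<^bsub>G\<^esub> inv\<^bsub>G\<^esub> k = g"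
    and "inv\<^bsub>G\<^esub> k \<otimes>\<^bsub>G\<^esub> (k \<otimes>\<^bsub>G\<^esub> g \<otimes>\<^bsub>G\<^esub> inv\<^bsub>G\<^esub> k) \<otimes>\<^bsub>G\<^esub> k = g"
  using assms by (simp_all add: m_assoc inv_cancel)

lemma lie_group_automorphism_conj:
  assumes k: "k \<in> carrier G"
  shows "lie_group_automorphism G (\<lambda>g. inv\<^bsub>G\<^esub> k \<otimes>\<^bsub>G\<^esub> g \<otimes>\<^bsub>G\<^esub> k)"
proof -
  let ?\<phi> = "\<lambda>g. inv\<^bsub>G\<^esub> k \<otimes>\<^bsub>G\<^esub> g \<otimes>\<^bsub>G\<^esub> k" and ?\<psi> = "\<lambda>g. k \<otimes>\<^bsub>G\<^esub> g \<otimes>\<^bsub>G\<^esub> inv\<^bsub>G\<^esub> k"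
  have bij: "bij_betw ?\<phi> (carrier G) (carrier G)"
    using k conj_cancel by (intro bij_betwI[of _ _ _ ?\<psi>]) auto
  have "?\<phi> (x \<otimes>\<^bsub>G\<^esub> y) = ?\<phi> x \<otimes>\<^bsub>G\<^esub> ?\<phi> y" if "x \<in> carrier G" "y \<in> carrier G" for x y
    using k that by (simp add: m_assoc inv_cancel)
  then have "?\<phi> \<in> iso G G" using bij k by (auto simp: iso_def hom_def)
  moreover have "inv_into (carrier G) ?\<phi> x = ?\<psi> x" if "x \<in> carrier G" for x
    using k conj_cancel that bij by (intro inv_into_f_eq) (auto simp: bij_betw_def)
  then have "continuous_on (carrier G) (inv_into (carrier G) ?\<phi>)"
    using continuous_on_translations[of k "inv\<^bsub>G\<^esub> k"] k by (simp cong: continuous_on_cong)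
  ultimately show ?thesis
    using continuous_on_translations k by (simp add: lie_group_automorphism_def)
qed

text \<open>As \<open>p\<close> is multiplicative, projection turns conjugation in \<open>G\<close>
  into one fixed linear map of matrices, which is its own differential.\<close>

lemma has_differential_conj:
  assumes "k \<in> carrier G"
  shows "has_differential G p (\<lambda>g. inv\<^bsub>G\<^esub> k \<otimes>\<^bsub>G\<^esub> g \<otimes>\<^bsub>G\<^esub> k) g (\<lambda>A. p (inv\<^bsub>G\<^esub> k) ** A ** p k)"
  unfolding has_differential_def
proof (intro conjI allI impI linear_matrix_conj)
  fix c v assume c: "continuous_on (UNIV :: real set) c \<and> range c \<subseteq> carrier G \<and> c 0 = g \<and>
        ((\<lambda>t. p (c t)) has_vector_derivative v) (at 0)"
  then have "p (inv\<^bsub>G\<^esub> k \<otimes>\<^bsub>G\<^esub> c t \<otimes>\<^bsub>G\<^esub> k) = p (inv\<^bsub>G\<^esub> k) ** p (c t) ** p k" for t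
    using assms by (simp add: projection_mult range_subsetD)
  moreover have "bounded_linear (\<lambda>A. p (inv\<^bsub>G\<^esub> k) ** A ** p k)"
    using linear_matrix_conj linear_conv_bounded_linear by blast
  ultimately show "((\<lambda>t. p (inv\<^bsub>G\<^esub> k \<otimes>\<^bsub>G\<^esub> c t \<otimes>\<^bsub>G\<^esub> k)) has_vector_derivative
      p (inv\<^bsub>G\<^esub> k) ** v ** p k) (at 0)"
    using bounded_linear.has_vector_derivative c by fastforce
qed

text \<open>As \<open>h'\<close> is \<open>h\<close> pulled back by conjugation with
  \<open>k\<close>, \<open>h\<close> is \<open>h'\<close> pulled back by the inverse conjugation; at
  the neutral element the basis is moved by conjugation with \<open>p k\<close>.\<close>

lemma lorentzian_left_invariant_conj:
  fixes h :: "'g \<Rightarrow> real^2^2 \<Rightarrow> real^2^2 \<Rightarrow> real"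
  assumes h: "lorentzian_left_invariant G p h" and k: "k \<in> carrier G"
  defines "h' \<equiv> \<lambda>g A B. h (k \<otimes>\<^bsub>G\<^esub> g \<otimes>\<^bsub>G\<^esub> inv\<^bsub>G\<^esub> k) (p k ** A ** p (inv\<^bsub>G\<^esub> k)) (p k ** B ** p (inv\<^bsub>G\<^esub> k))"
  shows "lorentzian_left_invariant G p h'" "isometric_via_automorphism G p h h'"
    "matrix_in_B0 G h' = gram (h \<one>\<^bsub>G\<^esub>) (\<chi> i. p k ** B0 $ i ** adj2 (p k))"
proof -
  let ?\<psi> = "\<lambda>g. k \<otimes>\<^bsub>G\<^esub> g \<otimes>\<^bsub>G\<^esub> inv\<^bsub>G\<^esub> k" and ?C = "\<lambda>A. p k ** A ** p (inv\<^bsub>G\<^esub> k)"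
    and ?D = "\<lambda>A. p (inv\<^bsub>G\<^esub> k) ** A ** p k"
  note pk = projection_inv[OF k]
  have CD: "?C (?D A) = A" and DC: "?D (?C A) = A" for A
    using pk(1,2) by (metis matrix_mul_assoc matrix_mul_lid matrix_mul_rid)+
  have C_in: "?C A \<in> tangent_at p (?\<psi> g)" if "A \<in> tangent_at p g" "g \<in> carrier G" for A g
    using tangent_at_conj[OF k that(2)] that(1) by blast
  have D_im: "?D ` tangent_at p (?\<psi> g) = tangent_at p g" if g: "g \<in> carrier G" for g
  proof
    show "?D ` tangent_at p (?\<psi> g) \<subseteq> tangent_at p g"
      using tangent_at_conj[of "inv\<^bsub>G\<^esub> k" "?\<psi> g"] k g conj_cancel(2)[OF k g] by simp
    show "tangent_at p g \<subseteq> ?D ` tangent_at p (?\<psi> g)"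
    proof
      fix A assume "A \<in> tangent_at p g"
      then show "A \<in> ?D ` tangent_at p (?\<psi> g)"
        using C_in g by (intro image_eqI[of A ?D "?C A"]) (simp_all only: DC)
    qed
  qed
  show "lorentzian_left_invariant G p h'"
    unfolding lorentzian_left_invariant_def
  proof (intro conjI ballI)
    fix g assume g: "g \<in> carrier G"
    have "lorentzian_form_on (tangent_at p (?\<psi> g)) (h (?\<psi> g))"
      using h g k by (simp add: lorentzian_left_invariant_def)
    then show "lorentzian_form_on (tangent_at p g) (h' g)"
      unfolding h'_def
      by (rule lorentzian_form_on_pullback[OF _ linear_matrix_conj linear_matrix_conj
         tangent_at_conj[OF k g] D_im[OF g] CD])
  next
    fix l g A B assume lg: "l \<in> carrier G" "g \<in> carrier G"
      and AB: "A \<in> tangent_at p g" "B \<in> tangent_at p g"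
    have 1: "?\<psi> (l \<otimes>\<^bsub>G\<^esub> g) = ?\<psi> l \<otimes>\<^bsub>G\<^esub> ?\<psi> g" using k lg by (simp add: m_assoc inv_cancel)
    \<comment> \<open>Conjugation by \<open>k\<close> turns left translation by \<open>l\<close>
      into left translation by the conjugate of \<open>l\<close>, so left invariance of
      \<open>h\<close> applies.\<close>
    have 2: "?C (p l ** A) = p (?\<psi> l) ** ?C A" for A
      using k lg pk by (simp add: projection_mult) (metis matrix_mul_assoc matrix_mul_rid)
    show "h' (l \<otimes>\<^bsub>G\<^esub> g) (p l ** A) (p l ** B) = h' g A B"
      unfolding h'_def 1 2 using h C_in AB lg k by (simp add: lorentzian_left_invariant_def)
  qed
  show "isometric_via_automorphism G p h h'"
    unfolding isometric_via_automorphism_def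
  proof (intro exI conjI ballI)
    show "lie_group_automorphism G (\<lambda>g. inv\<^bsub>G\<^esub> k \<otimes>\<^bsub>G\<^esub> g \<otimes>\<^bsub>G\<^esub> k)"
      by (rule lie_group_automorphism_conj[OF k])
    fix g assume g: "g \<in> carrier G"
    show "has_differential G p (\<lambda>g. inv\<^bsub>G\<^esub> k \<otimes>\<^bsub>G\<^esub> g \<otimes>\<^bsub>G\<^esub> k) g ((\<lambda>_. ?D) g)"
      using has_differential_conj[OF k] by simp
    show "h g A B = h' (inv\<^bsub>G\<^esub> k \<otimes>\<^bsub>G\<^esub> g \<otimes>\<^bsub>G\<^esub> k) ((\<lambda>_. ?D) g A) ((\<lambda>_. ?D) g B)" for A B
      unfolding h'_def CD conj_cancel(1)[OF k g] ..
  qed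
  have "?\<psi> \<one>\<^bsub>G\<^esub> = \<one>\<^bsub>G\<^esub>" using k by simp
  then show "matrix_in_B0 G h' = gram (h \<one>\<^bsub>G\<^esub>) (\<chi> i. p k ** B0 $ i ** adj2 (p k))"
    by (simp add: matrix_in_B0_def gram_def h'_def pk(3))
qed

text \<open>Surjectivity of \<open>p\<close> lifts the reducing matrix \<open>P\<close> to an
  element of \<open>G\<close>.\<close>

lemma left_invariant_normal_form:
  fixes h :: "'g \<Rightarrow> real^2^2 \<Rightarrow> real^2^2 \<Rightarrow> real"
  assumes h: "lorentzian_left_invariant G p h"
  shows "\<exists>h'. lorentzian_left_invariant G p h' \<and> isometric_via_automorphism G p h h' \<and>
    normal_form (matrix_in_B0 G h')"
proof -
  have "tangent_at p \<one>\<^bsub>G\<^esub> = sl2" by (simp add: tangent_at_def projection_one)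
  then have "lorentzian_form_on sl2 (h \<one>\<^bsub>G\<^esub>)"
    using h unfolding lorentzian_left_invariant_def by (metis one_closed)
  then obtain P where P: "det P = 1" "normal_form (gram (h \<one>\<^bsub>G\<^esub>) (\<chi> i. P ** B0 $ i ** adj2 P))"
    using lorentzian_form_normal_form by blast
  obtain k where k: "k \<in> carrier G" "p k = P" using projection_surj P(1) .
  show ?thesis
    using lorentzian_left_invariant_conj[OF h k(1)] P(2) unfolding k(2) by metis
qed

end

theorem theorem3p3:
  fixes G :: "('g::real_normed_vector) monoid"
    and p :: "'g \<Rightarrow> real^2^2"
    and h :: "'g \<Rightarrow> real^2^2 \<Rightarrow> real^2^2 \<Rightarrow> real"
  assumes "universal_covering_SL2 G p"
    and "lorentzian_left_invariant G p h"
  shows "\<exists>h'. lorentzian_left_invariant G p h' \<and> isometric_via_automorphism G p h h' \<and>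
    ((\<exists>\<mu>1 \<mu>2 \<mu>3. \<mu>1 > 0 \<and> \<mu>2 \<ge> \<mu>3 \<and> \<mu>3 > 0 \<and>
        matrix_in_B0 G h' =
          mat3 (- \<mu>1) 0 0
               0 \<mu>2 0
               0 0 \<mu>3) \<or>
     (\<exists>\<mu>1 \<mu>2 \<mu>3. \<mu>1 > 0 \<and> \<mu>2 > 0 \<and> \<mu>3 > 0 \<and>
        matrix_in_B0 G h' =
          mat3 \<mu>1 0 0
               0 (- \<mu>2) 0
               0 0 \<mu>3) \<or>
     (\<exists>a \<alpha> \<beta>. a \<noteq> 0 \<and> \<alpha> > 0 \<and> \<beta> > 0 \<and>
        matrix_in_B0 G h' = (4 / (a^2 * \<alpha> * sqrt (\<alpha>^2 + \<beta>^2))) *\<^sub>R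
          mat3 ((\<beta>^2 - \<alpha>^2) / sqrt (\<alpha>^2 + \<beta>^2)) \<beta> 0
               \<beta> (sqrt (\<alpha>^2 + \<beta>^2)) 0
               0 0 (a^2 * \<alpha> / sqrt (\<alpha>^2 + \<beta>^2))) \<or>
     (\<exists>a \<alpha> \<beta>. a \<noteq> 0 \<and> \<alpha> < 0 \<and> \<beta> > 0 \<and>
        matrix_in_B0 G h' = (4 / (a^2 * \<alpha> * sqrt (\<alpha>^2 + \<beta>^2))) *\<^sub>R
          mat3 (- sqrt (\<alpha>^2 + \<beta>^2)) 0 \<beta>
               0 (a^2 * \<alpha> / sqrt (\<alpha>^2 + \<beta>^2)) 0
               \<beta> 0 ((\<alpha>^2 - \<beta>^2) / sqrt (\<alpha>^2 + \<beta>^2))) \<or>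
     (\<exists>u v. v > 0 \<and> - v < u \<and> u < v \<and>
        matrix_in_B0 G h' = (16 / (v^2 - u^2)) *\<^sub>R
          mat3 u 0 v
               0 (2 * (u + v)) 0
               v 0 u) \<or>
     (\<exists>a b. a \<noteq> 0 \<and> b \<noteq> 0 \<and>
        matrix_in_B0 G h' = (1 / (2 * a * b)) *\<^sub>R
          mat3 (a - 8) (- a) 0
               (- a) (a + 8) 0
               0 0 (8 * a / b)) \<or>
     (\<exists>a. a \<noteq> 0 \<and>
        matrix_in_B0 G h' = (2 / (a^4 * (1 + 2 * a^2))) *\<^sub>R
          mat3 (1 - 4 * a^4) ((1 + 2 * a^2) powr (3/2)) 0
               ((1 + 2 * a^2) powr (3/2)) (4 * a^4 + 6 * a^2 + 1) (2 * sqrt 2 * a^3)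
               0 (2 * sqrt 2 * a^3) (4 * a^4)))"
  using left_invariant_normal_form[OF assms]
  unfolding normal_form_def normal_form1_def normal_form2_def normal_form3_def normal_form4_def
    normal_form5_def normal_form6_def normal_form7_def .

end
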